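(* Let $d\ge2$, fix $k\in\mathbb{N}$ and let $(r_1,\ldots,r_k)\in\mathbb{R}^k_+$. For $i=1,\ldots,k$ let $\Phi^{(i)}$ be independent homogeneous Poisson point processes in $\mathbb{R}^d$ of intensities $\lambda_i>0$. Set $r_0=\inf_{1\le i,j\le k}\{r_i+r_j\}$. If $$\prod_{i=1}^k\left(1-e^{-\lambda_i a(d,r_0)}\right)>p_c(d),$$ then almost surely, every word occurs.
   Context: A word is a sequence $\omega=\{w_i\}_{i\ge1}\in\{1,2,\ldots,k\}^{\mathbb{N}}$. It is said to occur if there exists a sequence of distinct points $\{X_i\}_{i\ge1}\subset\mathbb{R}^d$ such that $X_i\in\Phi^{(w_i)}$ and $|X_i-X_{i+1}|\le r_{w_i}+r_{w_{i+1}}$ for all $i\ge1$ ($|\cdot|$ is the Euclidean norm). The quantities $p_c(d)$ and $a(d,r)$, $r>0$, are defined as follows. For $d=2$: consider the triangular lattice in the plane with edge length $r/2$. $p_c(2)$ is the critical probability for Bernoulli site percolation on this lattice (it is known that $p_c(2)=1/2$). Around each vertex place the "flower" bounded by arcs of the 6 circles of radius $r/2$ centred at the mid-points of the 6 edges adjacent to the vertex, i.e. the flower is the intersection of the 6 closed discs of radius $r/2$ centred at these mid-points; $a(2,r)$ is the area of a flower. For $d\ge3$: $p_c(d)$ is the critical probability for Bernoulli site percolation on the graph with vertex set $\mathbb{Z}^d$ and edges between $z,z_1$ with $|z-z_1|_\infty=1$ ($l_\infty$-norm); and $a(d,r)=\left(\frac{r}{2\sqrt d}\right)^d$. *)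

theory Defs
  imports "HOL-Probability.Probability"
begin

section \<open>Point processes\<close>

definition locally_finite :: "'a::euclidean_space set \<Rightarrow> bool" where
  "locally_finite S \<longleftrightarrow> (\<forall>B. bounded B \<longrightarrow> finite (S \<inter> B))"

text \<open>Point configurations, with the \<open>\<sigma>\<close>-algebra generated by the counting maps
  \<open>S \<mapsto> card (S \<inter> B)\<close>, \<open>B\<close> bounded Borel.\<close>

definition config_space :: "'a::euclidean_space set measure" where
  "config_space = sigma {S. locally_finite S}
     {{S. locally_finite S \<and> card (S \<inter> B) = n} |B n. B \<in> sets borel \<and> bounded B}"

text \<open>A homogeneous Poisson point process has almost surely no multiple points, so it is
  represented by its random set of points.\<close>

definition poisson_process :: "'w measure \<Rightarrow> real \<Rightarrow> ('w \<Rightarrow> 'a::euclidean_space set) \<Rightarrow> bool" where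
  "poisson_process M l \<Phi> \<longleftrightarrow>
     \<Phi> \<in> measurable M config_space \<and>
     (\<forall>B n. B \<in> sets borel \<and> bounded B \<longrightarrow>
        measure M {\<omega> \<in> space M. card (\<Phi> \<omega> \<inter> B) = n} =
          (l * measure lborel B) ^ n / fact n * exp (- (l * measure lborel B))) \<and>
     (\<forall>(J :: nat set) B. finite J \<and> (\<forall>j\<in>J. B j \<in> sets borel \<and> bounded (B j)) \<and>
        disjoint_family_on B J \<longrightarrow>
        prob_space.indep_vars M (\<lambda>_. count_space UNIV) (\<lambda>j \<omega>. card (\<Phi> \<omega> \<inter> B j)) J)"

section \<open>Words\<close>

text \<open>Words and point sequences are indexed by the naturals \<open>\<ge> 1\<close>; the value at \<open>0\<close> is
  irrelevant.\<close>

definition words :: "nat \<Rightarrow> (nat \<Rightarrow> nat) set" where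
  "words k = ({1..} \<rightarrow> {1..k})"

definition word_occurs ::
    "(nat \<Rightarrow> 'a::euclidean_space set) \<Rightarrow> (nat \<Rightarrow> real) \<Rightarrow> (nat \<Rightarrow> nat) \<Rightarrow> bool" where
  "word_occurs S r w \<longleftrightarrow>
     (\<exists>X :: nat \<Rightarrow> 'a. inj_on X {1..} \<and>
        (\<forall>i\<ge>1. X i \<in> S (w i) \<and> norm (X i - X (i + 1)) \<le> r (w i) + r (w (i + 1))))"

section \<open>Bernoulli site percolation\<close>

definition site_measure :: "'v set \<Rightarrow> real \<Rightarrow> ('v \<Rightarrow> bool) measure" where
  "site_measure V p = PiM V (\<lambda>_. measure_pmf (bernoulli_pmf p))"

text \<open>The set of vertices joined to \<open>x\<close> by a path of open vertices (empty if \<open>x\<close> is closed).\<close>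

definition open_cluster ::
    "'v set \<Rightarrow> ('v \<Rightarrow> 'v \<Rightarrow> bool) \<Rightarrow> ('v \<Rightarrow> bool) \<Rightarrow> 'v \<Rightarrow> 'v set" where
  "open_cluster V adj \<eta> x =
     {y. \<eta> x \<and> (\<lambda>u v. u \<in> V \<and> v \<in> V \<and> adj u v \<and> \<eta> u \<and> \<eta> v)\<^sup>*\<^sup>* x y}"

definition percolation_prob :: "'v set \<Rightarrow> ('v \<Rightarrow> 'v \<Rightarrow> bool) \<Rightarrow> 'v \<Rightarrow> real \<Rightarrow> real" where
  "percolation_prob V adj x p =
     measure (site_measure V p) {\<eta> \<in> space (site_measure V p). infinite (open_cluster V adj \<eta> x)}"

definition critical_prob :: "'v set \<Rightarrow> ('v \<Rightarrow> 'v \<Rightarrow> bool) \<Rightarrow> 'v \<Rightarrow> real" where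
  "critical_prob V adj x = Sup {p \<in> {0..1}. percolation_prob V adj x p = 0}"

section \<open>The lattices and the constants\<close>

text \<open>The triangular lattice with edge length \<open>s\<close>; its edges join the points at distance \<open>s\<close>.\<close>

definition tri_lattice :: "real \<Rightarrow> (real^2) set" where
  "tri_lattice s =
     {s *\<^sub>R (of_int m *\<^sub>R vector [1, 0] + of_int n *\<^sub>R vector [1 / 2, sqrt 3 / 2]) |m n :: int. True}"

definition tri_adj :: "real \<Rightarrow> real^2 \<Rightarrow> real^2 \<Rightarrow> bool" where
  "tri_adj s u v \<longleftrightarrow> dist u v = s"

definition flower :: "real \<Rightarrow> real^2 \<Rightarrow> (real^2) set" where
  "flower r v = (\<Inter>u \<in> {u \<in> tri_lattice (r / 2). tri_adj (r / 2) v u}. cball (midpoint v u) (r / 2))"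

text \<open>\<open>\<int>\<^sup>d\<close> as functions on \<open>{..<d}\<close>, extended by \<open>undefined\<close>.\<close>

definition int_lattice :: "nat \<Rightarrow> (nat \<Rightarrow> int) set" where
  "int_lattice d = ({..<d} \<rightarrow>\<^sub>E UNIV)"

definition linf_adj :: "nat \<Rightarrow> (nat \<Rightarrow> int) \<Rightarrow> (nat \<Rightarrow> int) \<Rightarrow> bool" where
  "linf_adj d z z' \<longleftrightarrow> Max ((\<lambda>i. \<bar>z i - z' i\<bar>) ` {..<d}) = 1"

text \<open>The critical probability of the triangular lattice does not depend on its edge length,
  since rescaling is a graph isomorphism; edge length \<open>1\<close> is used. Both graphs are
  vertex-transitive, so the choice of the origin as root is immaterial as well.\<close>

definition p_c :: "nat \<Rightarrow> real" where
  "p_c d = (if d = 2 then critical_prob (tri_lattice 1) (tri_adj 1) 0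
            else critical_prob (int_lattice d) (linf_adj d) (\<lambda>i\<in>{..<d}. 0))"

definition a_const :: "nat \<Rightarrow> real \<Rightarrow> real" where
  "a_const d r = (if d = 2 then measure lborel (flower r 0) else (r / (2 * sqrt (real d))) ^ d)"

end

theory Submission
  imports Defs
begin

text \<open>Place disjoint cells of volume \<open>a(d, r\<^sub>0)\<close> at the vertices of the lattice, such that points in
  adjacent cells are at distance at most \<open>r\<^sub>0\<close>, and call a vertex open if its cell meets each of the
  \<open>k\<close> processes. The vertices are then open independently with probability
  \<open>\<Prod>i. 1 - exp (- \<lambda>\<^sub>i a(d, r\<^sub>0))\<close>, which exceeds the critical probability. By Kolmogorov's law there
  is almost surely an infinite open cluster, and by local finiteness an infinite self-avoiding open
  path. Along this path every word is found, by choosing in the \<open>i\<close>-th cell a point of the process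
  \<open>w\<^sub>i\<close>.\<close>

section \<open>Infinite clusters and rays\<close>

text \<open>Openness asks for all \<open>k\<close> processes at once, so the path is fixed before
  any word is named: a single null set serves uncountably many words, and the product in the
  hypothesis is the price. Points of a word are distinct because they lie in distinct cells, which
  is why the path may not revisit a site and the cells must be disjoint.

  The constants balance disjointness against distance. With s = r / (2 sqrt d), two adjacent cubes
  of side s fit into a cube of side 2s, whose diameter is r. In the plane, two adjacent flowers both
  lie in the disc of radius r / 2 about the midpoint of their common edge. The delicate point there
  is disjointness: up to boundary points a flower lies in the Voronoi cell of its centre, but its
  six discs only speak of the six nearest lattice points. An inequality for the form m^2 + m n + n^2
  settles all other lattice points.\<close>

lemma infinite_reachable_imp_ray:
  fixes R :: "'v \<Rightarrow> 'v \<Rightarrow> bool"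
  assumes fin: "\<And>u. finite {v. R u v}"
    and inf: "infinite {y. R\<^sup>*\<^sup>* x y}"
  shows "\<exists>f :: nat \<Rightarrow> 'v. inj f \<and> (\<forall>n. R (f n) (f (Suc n)))"
proof -
  \<comment> \<open>Koenig's lemma, with the set \<open>F\<close> of visited vertices carried along
    so that the path is self-avoiding: \<open>T F\<close> forbids steps into \<open>F\<close>.
    Forbidding a return to the start \<open>u\<close> as well loses no reachable vertex, because a
    walk can be cut at its last visit to \<open>u\<close>.\<close>
  define T where "T F = (\<lambda>u v. R u v \<and> v \<notin> F)" for F :: "'v set"
  have T_insert: "(T (insert u F))\<^sup>*\<^sup>* u y" if "(T F)\<^sup>*\<^sup>* u y" for F u y
    using that
  proof induction
    case (step y z)
    show ?case
    proof (cases "z = u")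
      case False
      with step.hyps(2) have "T (insert u F) y z" by (simp add: T_def)
      with step.IH show ?thesis by (rule rtranclp.rtrancl_into_rtrancl)
    qed simp
  qed simp
  define P where "P p \<longleftrightarrow> snd p \<in> fst p \<and> infinite {y. (T (fst p))\<^sup>*\<^sup>* (snd p) y}" for p
  define Q where "Q p q \<longleftrightarrow> R (snd p) (snd q) \<and> snd q \<notin> fst p \<and> fst q = insert (snd q) (fst p)" for p q
  have "\<exists>g. \<forall>n::nat. P (g n) \<and> Q (g n) (g (Suc n))"
  proof (rule dependent_nat_choice)
    have "T {} = R" by (simp add: T_def fun_eq_iff)
    then have "{y. R\<^sup>*\<^sup>* x y} \<subseteq> {y. (T {x})\<^sup>*\<^sup>* x y}" using T_insert[of "{}" x] by auto
    then have "P ({x}, x)" using inf by (auto simp: P_def dest: finite_subset)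
    then show "\<exists>p. P p" ..
  next
    fix p :: "'v set \<times> 'v" and n :: nat
    assume p: "P p"
    obtain F u where [simp]: "p = (F, u)" by (cases p)
    \<comment> \<open>Pigeonhole on the first step: one of the finitely many successors outside
      \<open>F\<close> still reaches infinitely many vertices.\<close>
    have "{y. (T F)\<^sup>*\<^sup>* u y} \<subseteq> insert u (\<Union>v\<in>{v. T F u v}. {y. (T F)\<^sup>*\<^sup>* v y})"
      by (auto elim: converse_rtranclpE)
    moreover have "infinite {y. (T F)\<^sup>*\<^sup>* u y}" using p by (simp add: P_def)
    moreover have "finite {v. T F u v}"
      by (rule finite_subset[OF _ fin[of u]]) (auto simp: T_def)
    ultimately have "\<not> (\<forall>v\<in>{v. T F u v}. finite {y. (T F)\<^sup>*\<^sup>* v y})"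
      using finite_UN_I[of "{v. T F u v}" "\<lambda>v. {y. (T F)\<^sup>*\<^sup>* v y}"] finite_subset by blast
    then obtain v where v: "T F u v" "infinite {y. (T F)\<^sup>*\<^sup>* v y}" by blast
    have "{y. (T F)\<^sup>*\<^sup>* v y} \<subseteq> {y. (T (insert v F))\<^sup>*\<^sup>* v y}" using T_insert[of F v] by auto
    then have "P (insert v F, v)" using v(2) by (auto simp: P_def dest: finite_subset)
    moreover have "Q p (insert v F, v)" using v(1) by (simp add: Q_def T_def)
    ultimately show "\<exists>q. P q \<and> Q p q" by blast
  qed
  then obtain g where P: "\<And>n::nat. P (g n)" and Q: "\<And>n. Q (g n) (g (Suc n))" by blast
  have mono: "fst (g m) \<subseteq> fst (g n)" if "m \<le> n" for m n
    using that by (rule lift_Suc_mono_le[rotated]) (use Q in \<open>auto simp: Q_def\<close>)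
  have neq: "snd (g m) \<noteq> snd (g n)" if less: "m < n" for m n
  proof -
    obtain n' where n': "n = Suc n'" "m \<le> n'" using less by (cases n) auto
    have "snd (g m) \<in> fst (g n')" using P[of m] mono[OF n'(2)] by (auto simp: P_def)
    then show ?thesis using Q[of n'] n'(1) by (auto simp: Q_def)
  qed
  have "inj (\<lambda>n. snd (g n))"
    by (rule injI) (metis neq linorder_neqE_nat)
  then show ?thesis using Q by (auto simp: Q_def)
qed

lemma infinite_open_cluster_imp_ray:
  assumes "\<And>u. u \<in> V \<Longrightarrow> finite {v \<in> V. adj u v}"
    and inf: "infinite (open_cluster V adj \<eta> x)"
  shows "\<exists>f :: nat \<Rightarrow> 'v. inj f \<and> (\<forall>n. f n \<in> V \<and> \<eta> (f n) \<and> adj (f n) (f (Suc n)))"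
proof -
  let ?R = "\<lambda>u v. u \<in> V \<and> v \<in> V \<and> adj u v \<and> \<eta> u \<and> \<eta> v"
  have "finite {v. ?R u v}" for u
    using assms(1)[of u] by (cases "u \<in> V") (auto elim: rev_finite_subset)
  moreover have "infinite {y. ?R\<^sup>*\<^sup>* x y}"
    using inf by (auto simp: open_cluster_def elim: contrapos_nn rev_finite_subset)
  ultimately obtain f :: "nat \<Rightarrow> 'v" where "inj f" "\<forall>n. ?R (f n) (f (Suc n))"
    using infinite_reachable_imp_ray[of ?R x] by blast
  then show ?thesis by blast
qed

lemma ray_imp_infinite_open_cluster:
  assumes "inj f" "\<And>n. f n \<in> V \<and> \<eta> (f n) \<and> adj (f n) (f (Suc n))"
  shows "infinite (open_cluster V adj \<eta> (f 0))"
proof -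
  let ?R = "\<lambda>u v. u \<in> V \<and> v \<in> V \<and> adj u v \<and> \<eta> u \<and> \<eta> v"
  have "?R\<^sup>*\<^sup>* (f 0) (f n)" for n
  proof (induction n)
    case (Suc n)
    have "?R (f n) (f (Suc n))" using assms(2) by blast
    with Suc show ?case by (rule rtranclp.rtrancl_into_rtrancl)
  qed simp
  then have "range f \<subseteq> open_cluster V adj \<eta> (f 0)"
    using assms(2) by (auto simp: open_cluster_def)
  then show ?thesis
    using range_inj_infinite[OF assms(1)] finite_subset by blast
qed

text \<open>The root is quantified because the event of an infinite cluster at a fixed root depends
  on single sites and is not a tail event.\<close>

definition percolates :: "'v set \<Rightarrow> ('v \<Rightarrow> 'v \<Rightarrow> bool) \<Rightarrow> ('v \<Rightarrow> bool) \<Rightarrow> bool" where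
  "percolates V adj \<eta> \<longleftrightarrow> (\<exists>x\<in>V. infinite (open_cluster V adj \<eta> x))"

lemma percolates_iff_ray:
  assumes "\<And>u. u \<in> V \<Longrightarrow> finite {v \<in> V. adj u v}"
  shows "percolates V adj \<eta> \<longleftrightarrow>
    (\<exists>f :: nat \<Rightarrow> 'v. inj f \<and> (\<forall>n. f n \<in> V \<and> \<eta> (f n) \<and> adj (f n) (f (Suc n))))"
proof
  assume "percolates V adj \<eta>"
  then obtain x where "infinite (open_cluster V adj \<eta> x)" by (auto simp: percolates_def)
  from infinite_open_cluster_imp_ray[of V adj, OF assms this]
  show "\<exists>f :: nat \<Rightarrow> 'v. inj f \<and> (\<forall>n. f n \<in> V \<and> \<eta> (f n) \<and> adj (f n) (f (Suc n)))" .
next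
  assume "\<exists>f :: nat \<Rightarrow> 'v. inj f \<and> (\<forall>n. f n \<in> V \<and> \<eta> (f n) \<and> adj (f n) (f (Suc n)))"
  then obtain f :: "nat \<Rightarrow> 'v" where f: "inj f" "\<And>n. f n \<in> V \<and> \<eta> (f n) \<and> adj (f n) (f (Suc n))"
    by blast
  from ray_imp_infinite_open_cluster[of f V \<eta> adj, OF this] f(2)
  show "percolates V adj \<eta>" unfolding percolates_def by blast
qed

text \<open>Deleting sites can break a cluster apart, so the argument is made with rays: an
  injective ray meets \<open>F\<close> only finitely often, and its tail is a ray outside
  \<open>F\<close>. This makes percolation a tail event.\<close>

lemma percolates_Diff_finite:
  assumes lf: "\<And>u. u \<in> V \<Longrightarrow> finite {v \<in> V. adj u v}"
    and "finite F"
  shows "percolates V adj \<eta> \<longleftrightarrow> percolates (V - F) adj \<eta>"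
proof -
  have lf': "finite {v \<in> V - F. adj u v}" if "u \<in> V - F" for u
    using that by (intro finite_subset[OF _ lf[of u]]) auto
  have "\<exists>g :: nat \<Rightarrow> 'a. inj g \<and> (\<forall>n. g n \<in> V - F \<and> \<eta> (g n) \<and> adj (g n) (g (Suc n)))"
    if f: "inj f" "\<forall>n. f n \<in> V \<and> \<eta> (f n) \<and> adj (f n) (f (Suc n))" for f :: "nat \<Rightarrow> 'a"
  proof -
    have "finite (f -` F)" using \<open>finite F\<close> f(1) by (rule finite_vimageI)
    then obtain N where N: "\<And>n. f n \<in> F \<Longrightarrow> n < N"
      by (auto simp: finite_nat_set_iff_bounded)
    have "f (n + N) \<notin> F" for n using N[of "n + N"] by auto
    then show ?thesis
      using f by (intro exI[of _ "\<lambda>n. f (n + N)"]) (auto intro!: injI dest: injD)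
  qed
  moreover have "percolates V adj \<eta> \<longleftrightarrow>
      (\<exists>f :: nat \<Rightarrow> 'a. inj f \<and> (\<forall>n. f n \<in> V \<and> \<eta> (f n) \<and> adj (f n) (f (Suc n))))"
    by (rule percolates_iff_ray[OF lf])
  moreover have "percolates (V - F) adj \<eta> \<longleftrightarrow>
      (\<exists>f :: nat \<Rightarrow> 'a. inj f \<and> (\<forall>n. f n \<in> V - F \<and> \<eta> (f n) \<and> adj (f n) (f (Suc n))))"
    by (rule percolates_iff_ray[OF lf'])
  ultimately show ?thesis by (metis DiffD1)
qed

section \<open>Site percolation with independent vertices\<close>

text \<open>Reachability is a countable union over path lengths and intermediate sites, and a subset
  of \<open>V\<close> is infinite iff it leaves every one of the countably many finite subsets of
  \<open>V\<close>. The measure \<open>N\<close> is arbitrary since the lemma serves the probability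
  space, its tail sigma-algebras and the Bernoulli product space.\<close>

lemma measurable_infinite_open_cluster:
  fixes \<eta> :: "'a \<Rightarrow> 'v \<Rightarrow> bool"
  assumes V: "countable V"
    and meas: "\<And>v. v \<in> V \<Longrightarrow> Measurable.pred N (\<lambda>\<omega>. \<eta> \<omega> v)"
    and x: "x \<in> V"
  shows "Measurable.pred N (\<lambda>\<omega>. infinite (open_cluster V adj (\<eta> \<omega>) x))"
proof -
  let ?R = "\<lambda>\<omega> u v. u \<in> V \<and> v \<in> V \<and> adj u v \<and> \<eta> \<omega> u \<and> \<eta> \<omega> v"
  have edge: "Measurable.pred N (\<lambda>\<omega>. ?R \<omega> u v)" for u v
    using meas by (cases "u \<in> V \<and> v \<in> V \<and> adj u v") auto
  have path: "Measurable.pred N (\<lambda>\<omega>. (?R \<omega> ^^ n) x y)" for n y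
  proof (induction n arbitrary: y)
    case (Suc n)
    have iff: "(?R \<omega> ^^ Suc n) x y \<longleftrightarrow> (\<exists>z\<in>V. (?R \<omega> ^^ n) x z \<and> ?R \<omega> z y)" for \<omega>
      by auto
    have "Measurable.pred N (\<lambda>\<omega>. (?R \<omega> ^^ n) x z \<and> ?R \<omega> z y)" for z
      by (rule pred_intros_logic(3)[OF Suc.IH edge])
    then show ?case unfolding iff by (rule measurable_pred_countable(2)[OF V])
  qed simp
  have "Measurable.pred N (\<lambda>\<omega>. \<eta> \<omega> x \<and> (\<exists>n. (?R \<omega> ^^ n) x y))" for y
    using path meas[OF x] by measurable
  then have mem: "Measurable.pred N (\<lambda>\<omega>. y \<in> open_cluster V adj (\<eta> \<omega>) x)" for y
    by (simp add: open_cluster_def rtranclp_power)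
  have sub: "open_cluster V adj (\<eta> \<omega>) x \<subseteq> V" for \<omega>
  proof
    fix y assume "y \<in> open_cluster V adj (\<eta> \<omega>) x"
    then have "(?R \<omega>)\<^sup>*\<^sup>* x y" by (simp add: open_cluster_def)
    then show "y \<in> V" by cases (use x in auto)
  qed
  have iff: "infinite (open_cluster V adj (\<eta> \<omega>) x) \<longleftrightarrow>
      (\<forall>B\<in>{B. finite B \<and> B \<subseteq> V}. \<exists>y\<in>V. y \<notin> B \<and> y \<in> open_cluster V adj (\<eta> \<omega>) x)" for \<omega>
  proof
    assume *: "infinite (open_cluster V adj (\<eta> \<omega>) x)"
    show "\<forall>B\<in>{B. finite B \<and> B \<subseteq> V}. \<exists>y\<in>V. y \<notin> B \<and> y \<in> open_cluster V adj (\<eta> \<omega>) x"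
    proof
      fix B assume "B \<in> {B. finite B \<and> B \<subseteq> V}"
      then have "\<not> open_cluster V adj (\<eta> \<omega>) x \<subseteq> B" using * finite_subset by blast
      then show "\<exists>y\<in>V. y \<notin> B \<and> y \<in> open_cluster V adj (\<eta> \<omega>) x" using sub[of \<omega>] by auto
    qed
  next
    assume *: "\<forall>B\<in>{B. finite B \<and> B \<subseteq> V}. \<exists>y\<in>V. y \<notin> B \<and> y \<in> open_cluster V adj (\<eta> \<omega>) x"
    show "infinite (open_cluster V adj (\<eta> \<omega>) x)"
    proof
      assume "finite (open_cluster V adj (\<eta> \<omega>) x)"
      with * sub[of \<omega>] show False by auto
    qed
  qed
  have "Measurable.pred N (\<lambda>\<omega>. y \<notin> B \<and> y \<in> open_cluster V adj (\<eta> \<omega>) x)" for y B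
    using mem[of y] by (cases "y \<in> B") simp_all
  then show ?thesis
    unfolding iff by (intro measurable_pred_countable V countable_Collect_finite_subset)
qed

lemma measurable_percolates:
  assumes "countable V" "\<And>v. v \<in> V \<Longrightarrow> Measurable.pred N (\<lambda>\<omega>. \<eta> \<omega> v)"
  shows "Measurable.pred N (\<lambda>\<omega>. percolates V adj (\<eta> \<omega>))"
  unfolding percolates_def
  by (rule measurable_pred_countable(2)[OF assms(1) measurable_infinite_open_cluster[OF assms]])

text \<open>Kolmogorov's law is applied along an enumeration \<open>e\<close> of the sites, with the
  sigma-algebras generated by the single events that \<open>e n\<close> is open. For each n,
  removing \<open>e 0\<close>, ..., \<open>e (n - 1)\<close> leaves the event unchanged and makes it
  measurable with respect to the remaining sites.\<close>

lemma (in prob_space) percolates_0_1: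
  fixes \<eta> :: "'a \<Rightarrow> 'v \<Rightarrow> bool"
  assumes V: "countable V" "infinite V"
    and lf: "\<And>u. u \<in> V \<Longrightarrow> finite {v \<in> V. adj u v}"
    and indep: "indep_events (\<lambda>v. {\<omega> \<in> space M. \<eta> \<omega> v}) V"
  shows "prob {\<omega> \<in> space M. percolates V adj (\<eta> \<omega>)} = 0 \<or>
         prob {\<omega> \<in> space M. percolates V adj (\<eta> \<omega>)} = 1"
proof -
  define e where "e = from_nat_into V"
  have e: "bij_betw e UNIV V"
    using V unfolding e_def by (rule bij_betw_from_nat_into)
  define E where "E n = {\<omega> \<in> space M. \<eta> \<omega> (e n)}" for n
  have ind: "indep_sets (\<lambda>n. {E n}) UNIV"
  proof -
    have "indep_events E UNIV"
    proof (rule indep_eventsI)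
      show "E i \<in> events" for i
        using indep bij_betwE[OF e] by (auto simp: E_def indep_events_def)
      fix J :: "nat set" assume J: "finite J" "J \<noteq> {}"
      have inj: "inj_on e J" using e by (auto simp: bij_betw_def intro: inj_on_subset)
      have "e ` J \<subseteq> V" "e ` J \<noteq> {}" "finite (e ` J)"
        using bij_betwE[OF e] J by auto
      with indep have "prob (\<Inter>v\<in>e ` J. {\<omega> \<in> space M. \<eta> \<omega> v}) =
          (\<Prod>v\<in>e ` J. prob {\<omega> \<in> space M. \<eta> \<omega> v})"
        unfolding indep_events_def by blast
      then show "prob (\<Inter>i\<in>J. E i) = (\<Prod>i\<in>J. prob (E i))"
        using inj by (simp add: prod.reindex E_def)
    qed
    then show ?thesis by (simp add: indep_events_def_alt)
  qed
  have Esub: "E n \<subseteq> space M" for n by (auto simp: E_def)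
  let ?A = "\<lambda>n. sigma_sets (space M) {E n}"
  show ?thesis
  proof (rule kolmogorov_0_1_law[of ?A])
    show "sigma_algebra (space M) (?A n)" for n
      using Esub by (intro sigma_algebra_sigma_sets) auto
    show "indep_sets ?A UNIV"
      using ind by (rule indep_sets_sigma) (simp add: Int_stable_def)
    show "{\<omega> \<in> space M. percolates V adj (\<eta> \<omega>)} \<in> tail_events ?A"
      unfolding tail_events_def
    proof
      fix n
      define N where "N = sigma (space M) (\<Union>m\<in>{n..}. ?A m)"
      have sub: "(\<Union>m\<in>{n..}. ?A m) \<subseteq> Pow (space M)"
        using Esub sigma_sets_into_sp[of "{E _}" "space M"] by blast
      have space_N: "space N = space M" and sets_N: "sets N = sigma_sets (space M) (\<Union>m\<in>{n..}. ?A m)"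
        using sub by (simp_all add: N_def)
      have "Measurable.pred N (\<lambda>\<omega>. percolates (V - e ` {..<n}) adj (\<eta> \<omega>))"
      proof (rule measurable_percolates)
        fix v assume v: "v \<in> V - e ` {..<n}"
        then obtain m where m: "v = e m" using e by (auto simp: bij_betw_def)
        with v have "n \<le> m" by (auto simp: not_less[symmetric])
        then have "E m \<in> sets N" unfolding sets_N by (intro sigma_sets.Basic) auto
        then show "Measurable.pred N (\<lambda>\<omega>. \<eta> \<omega> v)"
          by (simp add: pred_def space_N E_def m)
      qed (use V in auto)
      then have "{\<omega> \<in> space M. percolates (V - e ` {..<n}) adj (\<eta> \<omega>)} \<in> sets N"
        by (simp add: pred_def space_N)
      then show "{\<omega> \<in> space M. percolates V adj (\<eta> \<omega>)} \<in> sigma_sets (space M) (\<Union> (?A ` {n..}))"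
        using percolates_Diff_finite[of V adj "e ` {..<n}"] lf by (simp add: sets_N)
    qed
  qed
qed

text \<open>Independence of the events extends to the sigma-algebras they generate, so the joint law
  is the product of the marginals. A law on booleans is determined by its mass at
  \<open>True\<close>.\<close>

lemma (in prob_space) distr_site_measure:
  fixes \<eta> :: "'a \<Rightarrow> 'v \<Rightarrow> bool"
  assumes "V \<noteq> {}" and p: "p \<in> {0..1}"
    and indep: "indep_events (\<lambda>v. {\<omega> \<in> space M. \<eta> \<omega> v}) V"
    and prob: "\<And>v. v \<in> V \<Longrightarrow> prob {\<omega> \<in> space M. \<eta> \<omega> v} = p"
  shows "distr M (site_measure V p) (\<lambda>\<omega>. \<lambda>v\<in>V. \<eta> \<omega> v) = site_measure V p"
proof -
  let ?B = "measure_pmf (bernoulli_pmf p)"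
  have ev: "{\<omega> \<in> space M. \<eta> \<omega> v} \<in> events" if "v \<in> V" for v
    using indep that by (auto simp: indep_events_def)
  have rv: "random_variable ?B (\<lambda>\<omega>. \<eta> \<omega> v)" if "v \<in> V" for v
    using ev[OF that] by (simp add: measurable_pmf_measure2 pred_def[symmetric])
  have "indep_vars (\<lambda>_. ?B) (\<lambda>v \<omega>. \<eta> \<omega> v) V"
    unfolding indep_vars_def2
  proof (intro conjI ballI rv)
    have "indep_sets (\<lambda>v. sigma_sets (space M) {{\<omega> \<in> space M. \<eta> \<omega> v}}) V"
      using indep unfolding indep_events_def_alt by (rule indep_sets_sigma) (simp add: Int_stable_def)
    then show "indep_sets (\<lambda>v. {(\<lambda>\<omega>. \<eta> \<omega> v) -` A \<inter> space M |A. A \<in> sets ?B}) V"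
    proof (rule indep_sets_mono_sets, safe)
      fix v and A :: "bool set" assume "v \<in> V"
      let ?E = "{\<omega> \<in> space M. \<eta> \<omega> v}"
      interpret sigma_algebra "space M" "sigma_sets (space M) {?E}"
        by (rule sigma_algebra_sigma_sets) auto
      have E: "?E \<in> sigma_sets (space M) {?E}" by auto
      \<comment> \<open>There are only four sets of booleans, so each preimage is empty, the event,
        its complement or the whole space.\<close>
      have "A \<subseteq> {False, True}" by (metis UNIV_bool subset_UNIV)
      then have "A \<in> {{}, {True}, {False}, UNIV}" unfolding UNIV_bool by blast
      moreover have "(\<lambda>\<omega>. \<eta> \<omega> v) -` {True} \<inter> space M = ?E"
        "(\<lambda>\<omega>. \<eta> \<omega> v) -` {False} \<inter> space M = space M - ?E" by auto
      moreover have "space M - ?E \<in> sigma_sets (space M) {?E}" using E by (rule compl_sets)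
      ultimately show "(\<lambda>\<omega>. \<eta> \<omega> v) -` A \<inter> space M \<in> sigma_sets (space M) {?E}"
        using E by (elim insertE) (simp_all add: top del: vimage_Collect_eq)
    qed
  qed
  then have "distr M (\<Pi>\<^sub>M v\<in>V. ?B) (\<lambda>\<omega>. \<lambda>v\<in>V. \<eta> \<omega> v) = (\<Pi>\<^sub>M v\<in>V. distr M ?B (\<lambda>\<omega>. \<eta> \<omega> v))"
    using indep_vars_iff_distr_eq_PiM'[where I = V and M' = "\<lambda>_. ?B" and X = "\<lambda>v \<omega>. \<eta> \<omega> v"] rv \<open>V \<noteq> {}\<close> by blast
  also have "\<dots> = (\<Pi>\<^sub>M v\<in>V. ?B)"
  proof (rule PiM_cong[OF refl])
    fix v assume v: "v \<in> V"
    have T: "measure (distr M ?B (\<lambda>\<omega>. \<eta> \<omega> v)) {True} = p"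
      using prob[OF v] rv[OF v] by (simp add: measure_distr vimage_def Int_def conj_commute)
    interpret D: prob_space "distr M ?B (\<lambda>\<omega>. \<eta> \<omega> v)"
      using rv[OF v] by (rule prob_space_distr)
    have "UNIV - {True} = {False}" by auto
    with D.prob_compl[of "{True}"] T
    have F: "measure (distr M ?B (\<lambda>\<omega>. \<eta> \<omega> v)) {False} = 1 - p" by simp
    show "distr M ?B (\<lambda>\<omega>. \<eta> \<omega> v) = ?B"
    proof (rule measure_eqI_countable[of _ UNIV])
      fix b
      show "emeasure (distr M ?B (\<lambda>\<omega>. \<eta> \<omega> v)) {b} = emeasure ?B {b}"
        using T F p by (cases b) (simp_all add: D.emeasure_eq_measure emeasure_pmf_single)
    qed auto
  qed
  finally show ?thesis by (simp add: site_measure_def)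
qed

text \<open>The critical probability is a supremum of parameters at which the root almost surely has
  a finite cluster; a parameter above it therefore gives an infinite cluster at \<open>x\<close>
  with nonzero probability. This is transferred from the product measure to \<open>M\<close>, and
  the 0-1 law raises it to probability 1 for some root.\<close>

lemma (in prob_space) AE_percolates:
  fixes \<eta> :: "'a \<Rightarrow> 'v \<Rightarrow> bool"
  assumes V: "countable V" and x: "x \<in> V"
    and lf: "\<And>u. u \<in> V \<Longrightarrow> finite {v \<in> V. adj u v}"
    and indep: "indep_events (\<lambda>v. {\<omega> \<in> space M. \<eta> \<omega> v}) V"
    and prob: "\<And>v. v \<in> V \<Longrightarrow> prob {\<omega> \<in> space M. \<eta> \<omega> v} = p"
    and p: "critical_prob V adj x < p"
  shows "AE \<omega> in M. percolates V adj (\<eta> \<omega>)"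
proof -
  have p01: "p \<in> {0..1}" using prob[OF x] by auto
  have "p \<notin> {p \<in> {0..1}. percolation_prob V adj x p = 0}"
  proof
    assume "p \<in> {p \<in> {0..1}. percolation_prob V adj x p = 0}"
    then have "p \<le> critical_prob V adj x"
      unfolding critical_prob_def by (rule cSup_upper) (auto intro: bdd_aboveI[of _ 1])
    with p show False by simp
  qed
  with p01 have pos: "percolation_prob V adj x p \<noteq> 0" by simp
  let ?S = "site_measure V p"
  let ?C = "{\<eta> \<in> space ?S. infinite (open_cluster V adj \<eta> x)}"
  have ev: "Measurable.pred M (\<lambda>\<omega>. \<eta> \<omega> v)" if "v \<in> V" for v
    using indep that by (auto simp: indep_events_def pred_def)
  have f: "(\<lambda>\<omega>. \<lambda>v\<in>V. \<eta> \<omega> v) \<in> measurable M ?S"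
    unfolding site_measure_def using ev
    by (intro measurable_restrict) (simp add: measurable_pmf_measure2)
  have "Measurable.pred ?S (\<lambda>\<eta>. \<eta> v)" if "v \<in> V" for v
    using measurable_component_singleton[OF that, of "\<lambda>_. measure_pmf (bernoulli_pmf p)"]
    by (simp add: site_measure_def measurable_pmf_measure2)
  from measurable_infinite_open_cluster[OF V this x]
  have C: "?C \<in> sets ?S" by (simp add: pred_def)
  \<comment> \<open>Restricting to \<open>V\<close> alters the field only off \<open>V\<close>,
    where the cluster of \<open>x\<close> never looks.\<close>
  have eq: "open_cluster V adj (\<lambda>v\<in>V. \<eta> \<omega> v) x = open_cluster V adj (\<eta> \<omega>) x" for \<omega>
  proof -
    have "(\<lambda>u v. u \<in> V \<and> v \<in> V \<and> adj u v \<and> (\<lambda>v\<in>V. \<eta> \<omega> v) u \<and> (\<lambda>v\<in>V. \<eta> \<omega> v) v) =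
        (\<lambda>u v. u \<in> V \<and> v \<in> V \<and> adj u v \<and> \<eta> \<omega> u \<and> \<eta> \<omega> v)"
      by (auto simp: fun_eq_iff)
    then show ?thesis using x by (simp add: open_cluster_def)
  qed
  have "percolation_prob V adj x p = measure (distr M ?S (\<lambda>\<omega>. \<lambda>v\<in>V. \<eta> \<omega> v)) ?C"
    using x by (subst distr_site_measure[OF _ p01 indep prob]) (auto simp: percolation_prob_def)
  also have "\<dots> = prob ((\<lambda>\<omega>. \<lambda>v\<in>V. \<eta> \<omega> v) -` ?C \<inter> space M)"
    using f C by (rule measure_distr)
  also have "(\<lambda>\<omega>. \<lambda>v\<in>V. \<eta> \<omega> v) -` ?C \<inter> space M =
      {\<omega> \<in> space M. infinite (open_cluster V adj (\<eta> \<omega>) x)}"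
    using measurable_space[OF f] by (auto simp: eq)
  finally have pos': "prob {\<omega> \<in> space M. infinite (open_cluster V adj (\<eta> \<omega>) x)} \<noteq> 0"
    using pos by simp
  have ev_perc: "{\<omega> \<in> space M. percolates V adj (\<eta> \<omega>)} \<in> events"
    using measurable_percolates[OF V ev] by (simp add: pred_def)
  have "prob {\<omega> \<in> space M. infinite (open_cluster V adj (\<eta> \<omega>) x)} \<le>
      prob {\<omega> \<in> space M. percolates V adj (\<eta> \<omega>)}"
    using x ev_perc by (intro finite_measure_mono) (auto simp: percolates_def)
  with pos' have ne0: "prob {\<omega> \<in> space M. percolates V adj (\<eta> \<omega>)} \<noteq> 0"
    using measure_nonneg[of M] by (metis order_antisym)
  \<comment> \<open>An event of nonzero probability is nonempty, so some realisation has an infinite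
    cluster, hence an injective ray in \<open>V\<close>.\<close>
  have "infinite V"
  proof -
    obtain \<omega> where "infinite (open_cluster V adj (\<eta> \<omega>) x)"
      using pos' by (cases "\<exists>\<omega>. infinite (open_cluster V adj (\<eta> \<omega>) x)") auto
    from infinite_open_cluster_imp_ray[OF lf this]
    obtain f :: "nat \<Rightarrow> 'v" where "inj f" "range f \<subseteq> V" by blast
    then show ?thesis using range_inj_infinite finite_subset by blast
  qed
  from percolates_0_1[of V adj, OF V this lf indep] ne0
  have "prob {\<omega> \<in> space M. percolates V adj (\<eta> \<omega>)} = 1" by blast
  then show ?thesis using ev_perc by (simp add: prob_Collect_eq_1)
qed

section \<open>Poisson processes meeting disjoint cells\<close>

lemma space_config_space: "space config_space = {S. locally_finite S}"
  by (simp add: config_space_def space_measure_of_conv)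

text \<open>Hitting \<open>B\<close> is the complement of the generating event that the count is 0.
  Local finiteness matters here: \<open>card\<close> is also 0 on infinite sets.\<close>

lemma hitting_sets_config_space:
  fixes B :: "'a::euclidean_space set"
  assumes "B \<in> sets borel" "bounded B"
  shows "{S. locally_finite S \<and> S \<inter> B \<noteq> {}} \<in> sets config_space"
proof -
  have "{S :: 'a set. locally_finite S \<and> card (S \<inter> B) = 0} \<in> sets config_space"
    unfolding config_space_def using assms
    by (subst sets_measure_of) (auto intro!: sigma_sets.Basic)
  then have "space config_space - {S. locally_finite S \<and> card (S \<inter> B) = 0} \<in> sets config_space"
    by (rule sets.compl_sets)
  also have "space config_space - {S. locally_finite S \<and> card (S \<inter> B) = 0} =
      {S. locally_finite S \<and> S \<inter> B \<noteq> {}}"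
    using assms(2) by (auto simp: space_config_space locally_finite_def)
  finally show ?thesis .
qed

lemma hitting_all_sets_config_space:
  fixes C :: "'v \<Rightarrow> 'a::euclidean_space set"
  assumes "finite J" "\<And>v. v \<in> J \<Longrightarrow> C v \<in> sets borel \<and> bounded (C v)"
  shows "{S. locally_finite S \<and> (\<forall>v\<in>J. S \<inter> C v \<noteq> {})} \<in> sets config_space"
proof -
  have "{S \<in> space config_space. \<forall>v\<in>J. S \<inter> C v \<noteq> {}} \<in> sets config_space"
  proof (intro sets.sets_Collect_finite_All assms(1))
    fix v assume "v \<in> J"
    with assms(2) have "{S. locally_finite S \<and> S \<inter> C v \<noteq> {}} \<in> sets config_space"
      by (intro hitting_sets_config_space) auto
    then show "{S \<in> space config_space. S \<inter> C v \<noteq> {}} \<in> sets config_space"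
      by (simp add: space_config_space)
  qed
  then show ?thesis by (simp add: space_config_space)
qed

text \<open>Each cell is missed with the void probability exp (- l a), and counts in disjoint cells
  are independent. \<open>poisson_process\<close> states this independence for families indexed by
  naturals, hence the enumeration \<open>h\<close> of \<open>J\<close>.\<close>

lemma (in prob_space) prob_poisson_hits_all:
  fixes C :: "'v \<Rightarrow> 'b::euclidean_space set"
  assumes \<Phi>: "poisson_process M l \<Phi>"
    and J: "finite J" "J \<noteq> {}" and disj: "disjoint_family_on C J"
    and C: "\<And>v. v \<in> J \<Longrightarrow> C v \<in> sets borel \<and> bounded (C v) \<and> measure lborel (C v) = a"
  shows "prob {\<omega> \<in> space M. \<forall>v\<in>J. \<Phi> \<omega> \<inter> C v \<noteq> {}} = (1 - exp (- l * a)) ^ card J"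
proof -
  have lf: "locally_finite (\<Phi> \<omega>)" if "\<omega> \<in> space M" for \<omega>
    using \<Phi> that measurable_space[of \<Phi> M config_space] by (auto simp: poisson_process_def space_config_space)
  obtain h where h: "bij_betw h {0..<card J} J"
    using ex_bij_betw_nat_finite[OF J(1)] by blast
  let ?I = "{0..<card J}"
  let ?X = "\<lambda>j \<omega>. card (\<Phi> \<omega> \<inter> C (h j))"
  have hJ: "h j \<in> J" if "j \<in> ?I" for j using h that by (auto simp: bij_betw_def)
  have "disjoint_family_on (\<lambda>j. C (h j)) ?I"
    unfolding disjoint_family_on_def
  proof (intro ballI impI)
    fix i j assume ij: "i \<in> ?I" "j \<in> ?I" "i \<noteq> j"
    then have "h i \<noteq> h j" using h by (auto simp: bij_betw_def inj_on_def)
    then show "C (h i) \<inter> C (h j) = {}"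
      using disj hJ[OF ij(1)] hJ[OF ij(2)] by (auto simp: disjoint_family_on_def)
  qed
  moreover have "\<forall>j\<in>?I. C (h j) \<in> sets borel \<and> bounded (C (h j))" using C hJ by blast
  ultimately have indep: "indep_vars (\<lambda>_. count_space UNIV) ?X ?I"
    using \<Phi> unfolding poisson_process_def by (elim conjE allE[of _ ?I] allE[of _ "\<lambda>j. C (h j)"]) blast
  have I: "?I \<noteq> {}" using J by (auto simp: card_gt_0_iff)
  have hit: "?X j \<omega> \<noteq> 0 \<longleftrightarrow> \<Phi> \<omega> \<inter> C (h j) \<noteq> {}" if "j \<in> ?I" "\<omega> \<in> space M" for j \<omega>
    using lf[OF that(2)] C[OF hJ[OF that(1)]] by (auto simp: locally_finite_def)
  have "{\<omega> \<in> space M. \<forall>v\<in>J. \<Phi> \<omega> \<inter> C v \<noteq> {}} = (\<Inter>j\<in>?I. ?X j -` (- {0}) \<inter> space M)"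
  proof -
    have "(\<forall>v\<in>h ` ?I. \<Phi> \<omega> \<inter> C v \<noteq> {}) \<longleftrightarrow> (\<forall>j\<in>?I. ?X j \<omega> \<noteq> 0)"
      if "\<omega> \<in> space M" for \<omega>
      using hit[OF _ that] by simp
    moreover have "h ` ?I = J" using h by (simp add: bij_betw_def)
    ultimately have "(\<forall>v\<in>J. \<Phi> \<omega> \<inter> C v \<noteq> {}) \<longleftrightarrow> (\<forall>j\<in>?I. ?X j \<omega> \<noteq> 0)"
      if "\<omega> \<in> space M" for \<omega>
      using that by metis
    then have "{\<omega> \<in> space M. \<forall>v\<in>J. \<Phi> \<omega> \<inter> C v \<noteq> {}} = {\<omega> \<in> space M. \<forall>j\<in>?I. ?X j \<omega> \<noteq> 0}"
      by (rule Collect_cong[OF conj_cong[OF refl]])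
    then show ?thesis using I by auto
  qed
  then have "prob {\<omega> \<in> space M. \<forall>v\<in>J. \<Phi> \<omega> \<inter> C v \<noteq> {}} = (\<Prod>j\<in>?I. prob (?X j -` (- {0}) \<inter> space M))"
    using indep_varsD_finite[OF indep I, of "\<lambda>_. - {0}"] by simp
  also have "\<dots> = (\<Prod>j\<in>?I. 1 - exp (- l * a))"
  proof (rule prod.cong[OF refl])
    fix j assume j: "j \<in> ?I"
    have rv: "?X j \<in> measurable M (count_space UNIV)"
      using indep j by (auto simp: indep_vars_def2)
    then have ev: "?X j -` {0} \<inter> space M \<in> events" by (rule measurable_sets) simp
    have "?X j -` (- {0}) \<inter> space M = space M - (?X j -` {0} \<inter> space M)" by auto
    then have "prob (?X j -` (- {0}) \<inter> space M) = 1 - prob (?X j -` {0} \<inter> space M)"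
      using prob_compl[OF ev] by simp
    also have "?X j -` {0} \<inter> space M = {\<omega> \<in> space M. ?X j \<omega> = 0}" by auto
    also have "prob \<dots> = exp (- l * a)"
      using \<Phi> C[OF hJ[OF j]] unfolding poisson_process_def by simp
    finally show "prob (?X j -` (- {0}) \<inter> space M) = 1 - exp (- l * a)" .
  qed
  finally show ?thesis by simp
qed

text \<open>Two layers of independence: between processes, applied to the configurations that hit
  every cell of \<open>J\<close>, and within one process, between the cells.\<close>

lemma (in prob_space) prob_all_poisson_hit_all:
  fixes C :: "'v \<Rightarrow> 'b::euclidean_space set" and \<Phi> :: "nat \<Rightarrow> 'a \<Rightarrow> 'b set"
  assumes I: "finite I" "I \<noteq> {}"
    and \<Phi>: "\<And>i. i \<in> I \<Longrightarrow> poisson_process M (l i) (\<Phi> i)"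
    and indep: "indep_vars (\<lambda>_. config_space) \<Phi> I"
    and J: "finite J" "J \<noteq> {}" and disj: "disjoint_family_on C J"
    and C: "\<And>v. v \<in> J \<Longrightarrow> C v \<in> sets borel \<and> bounded (C v) \<and> measure lborel (C v) = a"
  shows "prob {\<omega> \<in> space M. \<forall>v\<in>J. \<forall>i\<in>I. \<Phi> i \<omega> \<inter> C v \<noteq> {}} =
    (\<Prod>i\<in>I. 1 - exp (- l i * a)) ^ card J"
proof -
  let ?H = "{S. locally_finite S \<and> (\<forall>v\<in>J. S \<inter> C v \<noteq> {})}"
  have H: "?H \<in> sets config_space"
    using J(1) C by (intro hitting_all_sets_config_space) auto
  have pre: "\<Phi> i -` ?H \<inter> space M = {\<omega> \<in> space M. \<forall>v\<in>J. \<Phi> i \<omega> \<inter> C v \<noteq> {}}" if "i \<in> I" for i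
    using \<Phi>[OF that] measurable_space[of "\<Phi> i" M config_space]
    by (auto simp: poisson_process_def space_config_space)
  have "{\<omega> \<in> space M. \<forall>v\<in>J. \<forall>i\<in>I. \<Phi> i \<omega> \<inter> C v \<noteq> {}} = (\<Inter>i\<in>I. \<Phi> i -` ?H \<inter> space M)"
    using pre I(2) by auto
  then have "prob {\<omega> \<in> space M. \<forall>v\<in>J. \<forall>i\<in>I. \<Phi> i \<omega> \<inter> C v \<noteq> {}} =
      (\<Prod>i\<in>I. prob (\<Phi> i -` ?H \<inter> space M))"
    using indep_varsD_finite[OF indep I(2,1), of "\<lambda>_. ?H"] H by simp
  also have "\<dots> = (\<Prod>i\<in>I. (1 - exp (- l i * a)) ^ card J)"
    by (intro prod.cong refl) (simp only: pre prob_poisson_hits_all[OF \<Phi> J disj C])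
  finally show ?thesis by (simp add: prod_power_distrib)
qed

text \<open>Graph, cells and distance bound are kept abstract so that both the planar flowers and
  the cubes of higher dimension are instances.\<close>

lemma (in prob_space) AE_every_word_occurs:
  fixes \<Phi> :: "nat \<Rightarrow> 'a \<Rightarrow> 'b::euclidean_space set" and C :: "'v \<Rightarrow> 'b set" and r l :: "nat \<Rightarrow> real"
  assumes k: "k \<ge> 1"
    and \<Phi>: "\<And>i. i \<in> {1..k} \<Longrightarrow> poisson_process M (l i) (\<Phi> i)"
    and indep: "indep_vars (\<lambda>_. config_space) \<Phi> {1..k}"
    and rho: "\<And>i j. i \<in> {1..k} \<Longrightarrow> j \<in> {1..k} \<Longrightarrow> \<rho> \<le> r i + r j"
    and V: "countable V" and x: "x \<in> V"
    and lf: "\<And>u. u \<in> V \<Longrightarrow> finite {v \<in> V. adj u v}"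
    and C: "\<And>v. v \<in> V \<Longrightarrow> C v \<in> sets borel \<and> bounded (C v) \<and> measure lborel (C v) = a"
    and disj: "disjoint_family_on C V"
    and close: "\<And>u v y z. u \<in> V \<Longrightarrow> v \<in> V \<Longrightarrow> adj u v \<Longrightarrow> y \<in> C u \<Longrightarrow> z \<in> C v \<Longrightarrow> dist y z \<le> \<rho>"
    and p: "critical_prob V adj x < (\<Prod>i=1..k. 1 - exp (- l i * a))"
  shows "AE \<omega> in M. \<forall>w\<in>words k. word_occurs (\<lambda>i. \<Phi> i \<omega>) r w"
proof -
  define \<eta> where "\<eta> \<omega> v \<longleftrightarrow> (\<forall>i\<in>{1..k}. \<Phi> i \<omega> \<inter> C v \<noteq> {})" for \<omega> v
  let ?p = "\<Prod>i=1..k. 1 - exp (- l i * a)"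
  \<comment> \<open>One formula yields both facts about the field: singletons give the marginals,
    and general finite \<open>J\<close> then gives independence.\<close>
  have prob_J: "prob {\<omega> \<in> space M. \<forall>v\<in>J. \<eta> \<omega> v} = ?p ^ card J"
    if "finite J" "J \<noteq> {}" "J \<subseteq> V" for J
    unfolding \<eta>_def
    using that k C disjoint_family_on_mono[OF that(3) disj]
    by (intro prob_all_poisson_hit_all[OF _ _ \<Phi> indep]) auto
  have prob1: "prob {\<omega> \<in> space M. \<eta> \<omega> v} = ?p" if "v \<in> V" for v
    using prob_J[of "{v}"] that by simp
  have "indep_events (\<lambda>v. {\<omega> \<in> space M. \<eta> \<omega> v}) V"
  proof (rule indep_eventsI)
    fix v assume v: "v \<in> V"
    show "{\<omega> \<in> space M. \<eta> \<omega> v} \<in> events"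
      unfolding \<eta>_def
    proof (intro sets.sets_Collect_finite_All)
      fix i assume i: "i \<in> {1..k}"
      have meas: "\<Phi> i \<in> measurable M config_space"
        using \<Phi>[OF i] by (simp add: poisson_process_def)
      have "\<Phi> i -` {S. locally_finite S \<and> S \<inter> C v \<noteq> {}} \<inter> space M \<in> events"
        using C[OF v] by (intro measurable_sets[OF meas] hitting_sets_config_space) auto
      also have "\<Phi> i -` {S. locally_finite S \<and> S \<inter> C v \<noteq> {}} \<inter> space M =
          {\<omega> \<in> space M. \<Phi> i \<omega> \<inter> C v \<noteq> {}}"
        using measurable_space[OF meas] by (auto simp: space_config_space)
      finally show "{\<omega> \<in> space M. \<Phi> i \<omega> \<inter> C v \<noteq> {}} \<in> events" .
    qed simp
  next
    fix J assume J: "J \<subseteq> V" "finite J" "J \<noteq> {}"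
    have "(\<Inter>v\<in>J. {\<omega> \<in> space M. \<eta> \<omega> v}) = {\<omega> \<in> space M. \<forall>v\<in>J. \<eta> \<omega> v}"
      using J(3) by auto
    moreover have "(\<Prod>v\<in>J. prob {\<omega> \<in> space M. \<eta> \<omega> v}) = ?p ^ card J"
      using J(1) prob1 by (subst prod.cong[OF refl, of _ _ "\<lambda>_. ?p"]) auto
    ultimately show "prob (\<Inter>v\<in>J. {\<omega> \<in> space M. \<eta> \<omega> v}) = (\<Prod>v\<in>J. prob {\<omega> \<in> space M. \<eta> \<omega> v})"
      using prob_J J by simp
  qed
  from AE_percolates[of V x adj, OF V x lf this prob1 p]
  have "AE \<omega> in M. percolates V adj (\<eta> \<omega>)" .
  then show ?thesis
  proof (rule eventually_mono, intro ballI)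
    fix \<omega> w
    assume "percolates V adj (\<eta> \<omega>)" and w: "w \<in> words k"
    then obtain f :: "nat \<Rightarrow> 'v" where f: "inj f" "\<And>n. f n \<in> V" "\<And>n. \<eta> \<omega> (f n)"
        "\<And>n. adj (f n) (f (Suc n))"
      using percolates_iff_ray[of V adj, OF lf] by blast
    have wk: "w n \<in> {1..k}" if "n \<ge> 1" for n
      using w that by (auto simp: words_def)
    \<comment> \<open>Letter n is read in the cell of \<open>f n\<close>. Openness does not depend
      on the word, so whatever letter comes, its process has a point there.\<close>
    have "\<exists>y. n \<ge> 1 \<longrightarrow> y \<in> \<Phi> (w n) \<omega> \<inter> C (f n)" for n
      using f(3)[of n] wk[of n] unfolding \<eta>_def by blast
    then obtain X where X: "\<And>n. n \<ge> 1 \<Longrightarrow> X n \<in> \<Phi> (w n) \<omega> \<inter> C (f n)" by metis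
    show "word_occurs (\<lambda>i. \<Phi> i \<omega>) r w"
      unfolding word_occurs_def
    proof (intro exI[of _ X] conjI allI impI)
      show "inj_on X {1..}"
      proof (rule inj_onI)
        fix m n :: nat assume mn: "m \<in> {1..}" "n \<in> {1..}" "X m = X n"
        then have "C (f m) \<inter> C (f n) \<noteq> {}" using X[of m] X[of n] by auto
        then have "f m = f n" using disj f(2) unfolding disjoint_family_on_def by blast
        then show "m = n" using f(1) by (simp add: inj_eq)
      qed
      fix n :: nat assume n: "n \<ge> 1"
      show "X n \<in> \<Phi> (w n) \<omega>" using X n by blast
      have "dist (X n) (X (n + 1)) \<le> \<rho>"
        using X[of n] X[of "n + 1"] n f(2,4) by (intro close[of "f n" "f (n + 1)"]) auto
      also have "\<rho> \<le> r (w n) + r (w (n + 1))" using n by (intro rho wk) auto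
      finally show "norm (X n - X (n + 1)) \<le> r (w n) + r (w (n + 1))"
        by (simp add: dist_norm)
    qed
  qed
qed

section \<open>Cubic cells\<close>

lemma prod_Basis_cart: "(\<Prod>b\<in>Basis. x \<bullet> b) = (\<Prod>i\<in>UNIV. x $ i)" for x :: "real^'n"
proof -
  have B: "Basis = range (\<lambda>i. axis i 1 :: real^'n)" by (auto simp: Basis_vec_def)
  have "inj (\<lambda>i. axis i 1 :: real^'n)" by (simp add: inj_def axis_eq_axis)
  from prod.reindex[OF this, of "\<lambda>b. x \<bullet> b"] show ?thesis
    unfolding B by (simp add: inner_axis o_def)
qed

lemma countable_int_lattice: "countable (int_lattice d)"
  unfolding int_lattice_def by (intro countable_PiE) auto

lemma linf_adjD: "linf_adj d z z' \<Longrightarrow> i < d \<Longrightarrow> \<bar>z i - z' i\<bar> \<le> 1"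
  unfolding linf_adj_def
  using Max_ge[of "(\<lambda>i. \<bar>z i - z' i\<bar>) ` {..<d}" "\<bar>z i - z' i\<bar>"] by auto

lemma finite_linf_neighbours: "finite {v \<in> int_lattice d. linf_adj d u v}"
proof (rule finite_subset)
  show "{v \<in> int_lattice d. linf_adj d u v} \<subseteq> (\<Pi>\<^sub>E i\<in>{..<d}. {u i - 1..u i + 1})"
  proof (intro subsetI PiE_I)
    fix v i assume v: "v \<in> {v \<in> int_lattice d. linf_adj d u v}"
    then show "v i = undefined" if "i \<notin> {..<d}"
      using that by (auto simp: int_lattice_def PiE_def extensional_def)
    show "v i \<in> {u i - 1..u i + 1}" if "i \<in> {..<d}"
      using v linf_adjD[of d u v i] that by auto
  qed
  show "finite (\<Pi>\<^sub>E i\<in>{..<d}. {u i - 1..u i + 1})" by (intro finite_PiE) auto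
qed

text \<open>Half-open sides make cubes of distinct lattice points disjoint. The map \<open>h\<close>
  matches the index type of the vectors with the naturals that index
  \<open>int_lattice\<close>.\<close>

definition cube :: "('d \<Rightarrow> nat) \<Rightarrow> real \<Rightarrow> (nat \<Rightarrow> int) \<Rightarrow> (real^'d) set" where
  "cube h s z = {x. \<forall>j. s * of_int (z (h j)) \<le> x $ j \<and> x $ j < s * (of_int (z (h j)) + 1)}"

lemma cube_bounds:
  "box (\<chi> j. s * of_int (z (h j))) (\<chi> j. s * (of_int (z (h j)) + 1)) \<subseteq> cube h s z"
  "cube h s z \<subseteq> cbox (\<chi> j. s * of_int (z (h j))) (\<chi> j. s * (of_int (z (h j)) + 1))"
  by (auto simp: cube_def mem_box_cart less_imp_le)

lemma borel_cube: "cube h s z \<in> sets borel"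
proof -
  have "cube h s z = (\<Inter>j. {x. x $ j \<ge> s * of_int (z (h j))} \<inter> {x. x $ j < s * (of_int (z (h j)) + 1)})"
    by (auto simp: cube_def)
  also have "\<dots> \<in> sets borel"
    by (intro sets.finite_INT sets.Int borel_closed borel_open
        closed_halfspace_component_ge_cart open_halfspace_component_lt_cart) auto
  finally show ?thesis .
qed

lemma bounded_cube: "bounded (cube h s z)"
  using cube_bounds(2) bounded_cbox bounded_subset by blast

text \<open>The cube is squeezed between an open and a closed box of the same volume.\<close>

lemma measure_cube:
  fixes h :: "'d::finite \<Rightarrow> nat"
  assumes "s > 0"
  shows "measure lborel (cube h s z) = s ^ CARD('d)"
proof -
  let ?l = "\<chi> j. s * of_int (z (h j)) :: real^'d" and ?u = "\<chi> j. s * (of_int (z (h j)) + 1) :: real^'d"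
  have le: "?l \<bullet> b \<le> ?u \<bullet> b" if "b \<in> Basis" for b
    using that assms by (auto simp: Basis_vec_def inner_axis)
  have "(\<Prod>b\<in>Basis. (?u - ?l) \<bullet> b) = s ^ CARD('d)"
    unfolding prod_Basis_cart by (simp add: algebra_simps)
  then have vol: "measure lborel (box ?l ?u) = s ^ CARD('d)" "measure lborel (cbox ?l ?u) = s ^ CARD('d)"
    using le by (simp_all add: measure_lborel_box_eq measure_lborel_cbox_eq)
  have fm: "cube h s z \<in> fmeasurable lborel"
    using borel_cube[of h s z] emeasure_bounded_finite[OF bounded_cube] by (simp add: fmeasurable_def)
  have "measure lborel (box ?l ?u) \<le> measure lborel (cube h s z)"
    by (rule measure_mono_fmeasurable[OF cube_bounds(1) _ fm]) simp
  moreover have "measure lborel (cube h s z) \<le> measure lborel (cbox ?l ?u)"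
    by (rule measure_mono_fmeasurable[OF cube_bounds(2)]) (auto simp: borel_cube)
  ultimately show ?thesis using vol by simp
qed

text \<open>A point determines its cube: the lattice coordinate is the floor of the point's
  coordinate divided by \<open>s\<close>.\<close>

lemma disjoint_cubes:
  fixes h :: "'d::finite \<Rightarrow> nat"
  assumes "s > 0" and h: "bij_betw h UNIV {..<d}"
  shows "disjoint_family_on (cube h s) (int_lattice d)"
  unfolding disjoint_family_on_def
proof (intro ballI impI, rule ccontr)
  fix z z' assume z: "z \<in> int_lattice d" "z' \<in> int_lattice d" "z \<noteq> z'" "cube h s z \<inter> cube h s z' \<noteq> {}"
  then obtain x where x: "x \<in> cube h s z" "x \<in> cube h s z'" by blast
  have fl: "z (h j) = \<lfloor>x $ j / s\<rfloor>" if "x \<in> cube h s z" for z j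
    using that assms(1) by (intro floor_unique[symmetric]) (auto simp: cube_def field_simps)
  have "z i = z' i" if "i \<in> {..<d}" for i
  proof -
    have "i \<in> range h" using that h by (simp add: bij_betw_def)
    then obtain j where "i = h j" ..
    then show ?thesis using fl[OF x(1), of j] fl[OF x(2), of j] by simp
  qed
  then have "z = z'" using z(1,2) unfolding int_lattice_def by (intro PiE_ext) auto
  then show False using z(3) by simp
qed

text \<open>Each coordinate differs by at most 2s, and the Euclidean norm costs a factor sqrt d.
  Setting the bound equal to \<open>r\<^sub>0\<close> gives the side
  \<open>r\<^sub>0 / (2 * sqrt d)\<close> in \<open>a_const\<close>.\<close>

lemma dist_adjacent_cubes:
  fixes h :: "'d::finite \<Rightarrow> nat"
  assumes s: "s > 0" and h: "bij_betw h UNIV {..<d}" and adj: "linf_adj d u v"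
    and x: "x \<in> cube h s u" and y: "y \<in> cube h s v"
  shows "dist x y \<le> 2 * s * sqrt (real CARD('d))"
proof -
  have comp: "\<bar>(x - y) $ j\<bar> \<le> 2 * s" for j
  proof -
    have "\<bar>u (h j) - v (h j)\<bar> \<le> 1"
      using linf_adjD[OF adj] h by (auto simp: bij_betw_def)
    then have "of_int (u (h j)) \<le> of_int (v (h j)) + (1::real)" "of_int (v (h j)) \<le> of_int (u (h j)) + (1::real)"
      by linarith+
    then have "s * of_int (u (h j)) \<le> s * (of_int (v (h j)) + 1)" "s * of_int (v (h j)) \<le> s * (of_int (u (h j)) + 1)"
      using s by (simp_all add: mult_left_mono)
    moreover have "s * of_int (u (h j)) \<le> x $ j" "x $ j < s * (of_int (u (h j)) + 1)"
      "s * of_int (v (h j)) \<le> y $ j" "y $ j < s * (of_int (v (h j)) + 1)"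
      using x y by (auto simp: cube_def)
    ultimately show ?thesis by (simp add: algebra_simps abs_le_iff)
  qed
  have "(norm (x - y))\<^sup>2 = (\<Sum>j\<in>UNIV. ((x - y) $ j)\<^sup>2)"
    by (simp add: norm_vec_def L2_set_def sum_nonneg)
  also have "\<dots> \<le> (\<Sum>j\<in>(UNIV::'d set). (2 * s)\<^sup>2)"
  proof (rule sum_mono)
    fix j
    show "((x - y) $ j)\<^sup>2 \<le> (2 * s)\<^sup>2"
      using power_mono[OF comp[of j] abs_ge_zero, of 2] by (simp only: power2_abs)
  qed
  also have "\<dots> = (2 * s * sqrt (real CARD('d)))\<^sup>2" by (simp add: power_mult_distrib)
  finally show ?thesis
    using s by (simp add: dist_norm power2_le_iff_abs_le)
qed

section \<open>Renaming coordinates\<close>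

text \<open>Flowers live in \<open>real^2\<close>, the processes in \<open>real^'d\<close> with an
  index type that merely has two elements. For bijective \<open>g\<close> this map is an isometry
  preserving Lebesgue measure, so cells can be pulled back along it.\<close>

definition reindex :: "('n \<Rightarrow> 'm) \<Rightarrow> real^'m \<Rightarrow> real^'n" where
  "reindex g x = (\<chi> i. x $ g i)"

lemma norm_reindex:
  fixes g :: "'n::finite \<Rightarrow> 'm::finite"
  assumes "bij g"
  shows "norm (reindex g x) = norm x"
  using sum.reindex_bij_betw[OF assms, of "\<lambda>i. (norm (x $ i))\<^sup>2"]
  by (simp add: norm_vec_def L2_set_def reindex_def)

lemma dist_reindex:
  fixes g :: "'n::finite \<Rightarrow> 'm::finite"
  assumes "bij g"
  shows "dist (reindex g x) (reindex g y) = dist x y"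
proof -
  have "reindex g x - reindex g y = reindex g (x - y)" by (simp add: reindex_def vec_eq_iff)
  then show ?thesis by (simp add: dist_norm norm_reindex[OF assms])
qed

lemma measurable_reindex:
  fixes g :: "'n::finite \<Rightarrow> 'm::finite"
  shows "reindex g \<in> borel_measurable borel"
  unfolding reindex_def by (intro borel_measurable_continuous_onI continuous_intros)

text \<open>Lebesgue measure is determined by its values on boxes, and the preimage of a box is the
  box with permuted sides.\<close>

lemma distr_lborel_reindex:
  fixes g :: "'n::finite \<Rightarrow> 'm::finite"
  assumes g: "bij g"
  shows "distr lborel borel (reindex g) = lborel"
proof (rule lborel_eqI[symmetric])
  fix l u :: "real^'n"
  assume le: "\<And>b. b \<in> Basis \<Longrightarrow> l \<bullet> b \<le> u \<bullet> b"
  let ?r = "\<lambda>x :: real^'n. (\<chi> j. x $ inv g j) :: real^'m"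
  have ginv: "inv g (g i) = i" "g (inv g j) = j" for i j
    using g by (simp_all add: bij_is_inj bij_is_surj surj_f_inv_f)
  have *: "(\<forall>i. P (g i) i) \<longleftrightarrow> (\<forall>j. P j (inv g j))" for P
  proof
    assume *: "\<forall>i. P (g i) i"
    have "P j (inv g j)" for j using spec[OF *, of "inv g j"] by (simp only: ginv)
    then show "\<forall>j. P j (inv g j)" ..
  next
    assume *: "\<forall>j. P j (inv g j)"
    have "P (g i) i" for i using spec[OF *, of "g i"] by (simp only: ginv)
    then show "\<forall>i. P (g i) i" ..
  qed
  have "reindex g -` box l u = box (?r l) (?r u)"
  proof (rule set_eqI)
    fix x
    show "x \<in> reindex g -` box l u \<longleftrightarrow> x \<in> box (?r l) (?r u)"
      using *[of "\<lambda>j i. l $ i < x $ j \<and> x $ j < u $ i"]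
      by (simp only: vimage_eq reindex_def mem_box_cart vec_lambda_beta)
  qed
  moreover have "emeasure lborel (box (?r l) (?r u)) = (\<Prod>b\<in>Basis. (?r u - ?r l) \<bullet> b)"
  proof (rule emeasure_lborel_box)
    fix b :: "real^'m" assume "b \<in> Basis"
    then obtain j where "b = axis j 1" by (auto simp: Basis_vec_def)
    then show "?r l \<bullet> b \<le> ?r u \<bullet> b"
      using le[of "axis (inv g j) 1"] by (simp add: inner_axis axis_in_Basis_iff)
  qed
  moreover have "(\<Prod>b\<in>Basis. (?r u - ?r l) \<bullet> b) = (\<Prod>b\<in>Basis. (u - l) \<bullet> b)"
    unfolding prod_Basis_cart
    using prod.reindex_bij_betw[OF bij_imp_bij_inv[OF g], of "\<lambda>i. (u - l) $ i"] by simp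
  ultimately show "emeasure (distr lborel borel (reindex g)) (box l u) = (\<Prod>b\<in>Basis. (u - l) \<bullet> b)"
    by (simp add: emeasure_distr measurable_reindex)
qed simp

lemma measure_vimage_reindex:
  fixes g :: "'n::finite \<Rightarrow> 'm::finite"
  assumes "bij g" "A \<in> sets borel"
  shows "measure lborel (reindex g -` A) = measure lborel A"
  using assms(2) measure_distr[of "reindex g" lborel borel A]
  by (simp add: distr_lborel_reindex[OF assms(1)] measurable_reindex)

section \<open>Flower-shaped cells\<close>

definition tri :: "int \<Rightarrow> int \<Rightarrow> real^2" where
  "tri m n = of_int m *\<^sub>R vector [1, 0] + of_int n *\<^sub>R vector [1 / 2, sqrt 3 / 2]"

lemma tri_lattice_eq: "tri_lattice s = {s *\<^sub>R tri m n |m n. True}"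
  by (simp add: tri_lattice_def tri_def)

lemma tri_add: "tri m n + tri m' n' = tri (m + m') (n + n')"
  and tri_diff: "tri m n - tri m' n' = tri (m - m') (n - n')"
  and tri_0: "tri 0 0 = 0"
  by (simp_all add: tri_def algebra_simps)

lemma inner_tri: "x \<bullet> tri m n = of_int m * (x \<bullet> tri 1 0) + of_int n * (x \<bullet> tri 0 1)"
  by (simp add: tri_def inner_add_right)

text \<open>The basis vectors have norm 1 and inner product 1/2, which produces the norm form of the
  Eisenstein integers.\<close>

lemma tri_inner_self: "tri m n \<bullet> tri m n = of_int (m\<^sup>2 + m * n + n\<^sup>2)"
  by (simp add: tri_def inner_vec_def sum_2 vector_2 algebra_simps power2_eq_square)

lemma norm_tri_eq_1_iff: "norm (tri m n) = 1 \<longleftrightarrow> m\<^sup>2 + m * n + n\<^sup>2 = 1"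
  by (simp only: norm_eq_1 tri_inner_self of_int_eq_1_iff)

text \<open>Completing the square bounds 4 times the form below by 3 m^2, which is at least 12 once
  m has absolute value at least 2.\<close>

lemma int_abs_le_1:
  fixes m n :: int
  assumes "m\<^sup>2 + m * n + n\<^sup>2 = 1"
  shows "\<bar>m\<bar> \<le> 1"
proof (rule ccontr)
  assume "\<not> \<bar>m\<bar> \<le> 1"
  then have "2\<^sup>2 \<le> \<bar>m\<bar>\<^sup>2" by (intro power_mono) auto
  moreover have "4 * (m\<^sup>2 + m * n + n\<^sup>2) = 3 * m\<^sup>2 + (m + 2 * n)\<^sup>2"
    by (simp add: power2_eq_square algebra_simps)
  moreover have "(m + 2 * n)\<^sup>2 \<ge> 0" by simp
  ultimately show False using assms by simp
qed

lemma countable_tri_lattice: "countable (tri_lattice s)"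
proof -
  have "tri_lattice s = range (\<lambda>(m, n). s *\<^sub>R tri m n)" by (auto simp: tri_lattice_eq)
  then show ?thesis by simp
qed

lemma tri_lattice_diff: "u \<in> tri_lattice s \<Longrightarrow> v \<in> tri_lattice s \<Longrightarrow> u - v \<in> tri_lattice s"
  unfolding tri_lattice_eq by (clarsimp simp: tri_diff simp flip: scaleR_diff_right) blast

lemma tri_lattice_add: "u \<in> tri_lattice s \<Longrightarrow> v \<in> tri_lattice s \<Longrightarrow> u + v \<in> tri_lattice s"
  unfolding tri_lattice_eq by (clarsimp simp: tri_add simp flip: scaleR_add_right) blast

lemma zero_in_tri_lattice: "0 \<in> tri_lattice s"
  using tri_0 by (force simp: tri_lattice_eq)

lemma finite_tri_neighbours:
  assumes "u \<in> tri_lattice 1"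
  shows "finite {v \<in> tri_lattice 1. tri_adj 1 u v}"
proof (rule finite_subset)
  let ?S = "{-1..1} \<times> {-1..1 :: int}"
  show "{v \<in> tri_lattice 1. tri_adj 1 u v} \<subseteq> (\<lambda>(i, j). u - tri i j) ` ?S"
  proof
    fix v assume v: "v \<in> {v \<in> tri_lattice 1. tri_adj 1 u v}"
    then obtain i j where ij: "u - v = tri i j"
      using tri_lattice_diff[OF assms, of v] by (auto simp: tri_lattice_eq)
    have "norm (tri i j) = 1" using v ij by (simp add: tri_adj_def dist_norm)
    then have "i\<^sup>2 + i * j + j\<^sup>2 = 1" by (simp only: norm_tri_eq_1_iff)
    then have "\<bar>i\<bar> \<le> 1" "\<bar>j\<bar> \<le> 1"
      using int_abs_le_1[of i j] int_abs_le_1[of j i] by (simp_all add: ac_simps)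
    then have "(i, j) \<in> ?S" by auto
    moreover have "v = u - tri i j" using ij by (simp add: algebra_simps)
    ultimately show "v \<in> (\<lambda>(i, j). u - tri i j) ` ?S" by (intro rev_image_eqI[of "(i, j)"]) auto
  qed
qed simp

section \<open>Flowers, their translates and their disjointness\<close>

lemma midpoint_add: "midpoint v (v + e) = v + e /\<^sub>R 2" for v e :: "'a::real_vector"
proof -
  have "(v + e /\<^sub>R 2) + (v + e /\<^sub>R 2) = v + (v + (e /\<^sub>R 2 + e /\<^sub>R 2))" by (simp only: ac_simps)
  also have "e /\<^sub>R 2 + e /\<^sub>R 2 = e" by (simp flip: scaleR_left_distrib)
  finally show ?thesis by (simp add: midpoint_eq_iff)
qed

definition tri_nbrs :: "real \<Rightarrow> real^2 \<Rightarrow> (real^2) set" where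
  "tri_nbrs s v = {u \<in> tri_lattice s. tri_adj s v u}"

lemma flower_eq: "flower (2 * s) v = (\<Inter>u\<in>tri_nbrs s v. cball (midpoint v u) s)"
  by (simp add: flower_def tri_nbrs_def)

lemma tri_nbrs_iff:
  assumes "v \<in> tri_lattice s"
  shows "v + e \<in> tri_nbrs s v \<longleftrightarrow> e \<in> tri_lattice s \<and> norm e = s"
  using tri_lattice_add[OF assms, of e] tri_lattice_diff[of "v + e" s v] assms
  by (auto simp: tri_nbrs_def tri_adj_def dist_norm)

text \<open>In terms of edge vectors \<open>e\<close> the condition involves only
  \<open>x - v\<close>, so all flowers are translates of the one at the origin. The scale
  \<open>s\<close> is the edge length, half the parameter of \<open>flower\<close>.\<close>

lemma mem_flower_iff:
  assumes "v \<in> tri_lattice s"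
  shows "x \<in> flower (2 * s) v \<longleftrightarrow> (\<forall>e\<in>tri_lattice s. norm e = s \<longrightarrow> norm (x - v - e /\<^sub>R 2) \<le> s)"
proof -
  have "(\<forall>u. P u) \<longleftrightarrow> (\<forall>e. P (v + e))" for P
  proof
    assume *: "\<forall>e. P (v + e)"
    have "P u" for u using spec[OF *, of "u - v"] by simp
    then show "\<forall>u. P u" ..
  qed simp
  then have "x \<in> flower (2 * s) v \<longleftrightarrow> (\<forall>e. v + e \<in> tri_nbrs s v \<longrightarrow> dist (midpoint v (v + e)) x \<le> s)"
    unfolding flower_eq INT_iff Ball_def mem_cball .
  moreover have "dist (midpoint v (v + e)) x = norm (x - v - e /\<^sub>R 2)" for e
    unfolding midpoint_add by (metis dist_commute dist_norm diff_diff_eq)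
  ultimately show ?thesis by (auto simp: tri_nbrs_iff[OF assms])
qed

lemma closed_flower: "closed (flower r v)"
  unfolding flower_def by (intro closed_INT) auto

lemma bounded_flower:
  assumes "s > 0" "v \<in> tri_lattice s"
  shows "bounded (flower (2 * s) v)"
proof -
  have "norm (s *\<^sub>R tri 1 0) = s" using assms norm_tri_eq_1_iff[of 1 0] by simp
  moreover have "s *\<^sub>R tri 1 0 \<in> tri_lattice s" by (auto simp: tri_lattice_eq)
  ultimately have "v + s *\<^sub>R tri 1 0 \<in> tri_nbrs s v" using tri_nbrs_iff[OF assms(2)] by blast
  then have "flower (2 * s) v \<subseteq> cball (midpoint v (v + s *\<^sub>R tri 1 0)) s"
    unfolding flower_eq by blast
  then show ?thesis using bounded_cball bounded_subset by blast
qed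

lemma measure_flower:
  assumes "v \<in> tri_lattice s"
  shows "measure lborel (flower (2 * s) v) = measure lborel (flower (2 * s) 0)"
proof -
  have *: "x \<in> flower (2 * s) v \<longleftrightarrow> x - v \<in> flower (2 * s) 0" for x
    by (simp add: mem_flower_iff[OF assms] mem_flower_iff[OF zero_in_tri_lattice])
  have "flower (2 * s) v = (+) v ` flower (2 * s) 0"
  proof (intro set_eqI iffI)
    fix x assume "x \<in> flower (2 * s) v"
    then show "x \<in> (+) v ` flower (2 * s) 0" using * by (intro image_eqI[of _ _ "x - v"]) auto
  qed (auto simp: *)
  then have "measure lebesgue (flower (2 * s) v) = measure lebesgue (flower (2 * s) 0)"
    by (simp add: measure_translation)
  then show ?thesis by (simp add: measure_completion closed_flower borel_closed)
qed

text \<open>Neighbouring closed flowers touch at the midpoint of their centres; removing these midpoints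
  makes the cells disjoint without changing their area.\<close>

definition petals :: "real \<Rightarrow> real^2 \<Rightarrow> (real^2) set" where
  "petals s v = flower (2 * s) v - midpoint v ` tri_nbrs s v"

lemma countable_midpoints: "countable (midpoint v ` tri_nbrs s v)"
proof -
  have "tri_nbrs s v \<subseteq> tri_lattice s" by (auto simp: tri_nbrs_def)
  then show ?thesis using countable_tri_lattice by (intro countable_image) (rule countable_subset)
qed

lemma borel_petals: "petals s v \<in> sets borel"
proof -
  have "midpoint v ` tri_nbrs s v \<in> sets borel"
    by (rule sets.countable[OF _ countable_midpoints]) simp
  then show ?thesis
    unfolding petals_def by (rule sets.Diff[OF borel_closed[OF closed_flower]])
qed

lemma measure_petals:
  assumes "v \<in> tri_lattice s"
  shows "measure lborel (petals s v) = measure lborel (flower (2 * s) 0)"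
proof -
  have "midpoint v ` tri_nbrs s v \<in> null_sets lborel"
    using countable_midpoints by (rule countable_imp_null_set_lborel)
  then show ?thesis
    unfolding petals_def using measure_flower[OF assms] closed_flower
    by (subst measure_Diff_null_set) (auto simp: borel_closed)
qed

text \<open>The disc to use is that of the opposite edge, with centre v - e/2: it is tangent to the
  bisector of v and v + e, touching it only at the midpoint v + e/2, which \<open>petals\<close>
  omits. Hence the strict inequality, i.e. x is closer to v than to v + e.\<close>

lemma inner_petals_less:
  assumes "v \<in> tri_lattice s" "x \<in> petals s v" "e \<in> tri_lattice s" "norm e = s"
  shows "(x - v) \<bullet> e < s\<^sup>2 / 2"
proof (rule ccontr)
  assume *: "\<not> (x - v) \<bullet> e < s\<^sup>2 / 2"
  have "- e \<in> tri_lattice s"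
    using tri_lattice_diff[OF zero_in_tri_lattice assms(3)] by simp
  then have "norm (x - v - (- e) /\<^sub>R 2) \<le> s"
    using assms(2,4) mem_flower_iff[OF assms(1), of x] by (auto simp: petals_def)
  then have "(norm (x - v + e /\<^sub>R 2))\<^sup>2 \<le> s\<^sup>2" by (simp add: power_mono)
  moreover have "(norm (x - v - e /\<^sub>R 2))\<^sup>2 = (norm (x - v + e /\<^sub>R 2))\<^sup>2 - 2 * ((x - v) \<bullet> e)"
    by (simp add: power2_norm_eq_inner inner_add_left inner_add_right inner_diff_left
        inner_diff_right inner_commute algebra_simps)
  ultimately have "(norm (x - v - e /\<^sub>R 2))\<^sup>2 \<le> 0" using * by simp
  then have "x = v + e /\<^sub>R 2" by (simp add: algebra_simps)
  also have "\<dots> = midpoint v (v + e)" by (rule midpoint_add[symmetric])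
  finally have "x \<in> midpoint v ` tri_nbrs s v"
    using tri_nbrs_iff[OF assms(1), of e] assms(3,4) by blast
  then show False using assms(2) by (simp add: petals_def)
qed

text \<open>Each linear term is at most S times the absolute value of its coefficient, strictly if
  that is nonzero. Integrality gives |p| \<le> p^2, and the cross term p q only helps when it is
  nonnegative.\<close>

lemma same_sign_form_less:
  fixes p q :: int and P Q S :: real
  assumes "\<bar>P\<bar> < S / 2" "\<bar>Q\<bar> < S / 2" "p * q \<ge> 0" "p \<noteq> 0 \<or> q \<noteq> 0"
  shows "2 * (of_int p * P + of_int q * Q) < S * of_int (p\<^sup>2 + p * q + q\<^sup>2)"
proof -
  have S: "S > 0" using assms(1) by linarith
  have sq: "\<bar>p\<bar> \<le> p\<^sup>2" for p :: int
  proof (cases "p = 0")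
    case False
    then have "\<bar>p\<bar> * 1 \<le> \<bar>p\<bar> * \<bar>p\<bar>" by (intro mult_left_mono) auto
    then show ?thesis by (simp add: power2_eq_square)
  qed simp
  have le: "2 * (of_int p * P) \<le> S * of_int \<bar>p\<bar>" and less: "p \<noteq> 0 \<Longrightarrow> 2 * (of_int p * P) < S * of_int \<bar>p\<bar>"
    if "\<bar>P\<bar> < S / 2" for p :: int and P
  proof -
    have a: "of_int p * P \<le> of_int \<bar>p\<bar> * \<bar>P\<bar>"
      by (metis abs_ge_self abs_mult of_int_abs)
    have "of_int \<bar>p\<bar> * \<bar>P\<bar> \<le> of_int \<bar>p\<bar> * (S / 2)"
      using that by (intro mult_left_mono) auto
    with a show "2 * (of_int p * P) \<le> S * of_int \<bar>p\<bar>" by (simp add: mult.commute)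
    assume "p \<noteq> 0"
    then have "of_int \<bar>p\<bar> * \<bar>P\<bar> < of_int \<bar>p\<bar> * (S / 2)"
      using that by (intro mult_strict_left_mono) auto
    with a show "2 * (of_int p * P) < S * of_int \<bar>p\<bar>" by (simp add: mult.commute)
  qed
  have "2 * (of_int p * P + of_int q * Q) < S * of_int \<bar>p\<bar> + S * of_int \<bar>q\<bar>"
    using assms(4)
  proof
    assume "p \<noteq> 0"
    then show ?thesis using less[OF assms(1), of p] le[OF assms(2), of q] by (simp add: algebra_simps)
  next
    assume "q \<noteq> 0"
    then show ?thesis using le[OF assms(1), of p] less[OF assms(2), of q] by (simp add: algebra_simps)
  qed
  also have "\<dots> = S * of_int (\<bar>p\<bar> + \<bar>q\<bar>)" by (simp add: algebra_simps)
  also have "\<dots> \<le> S * of_int (p\<^sup>2 + p * q + q\<^sup>2)"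
    using S sq[of p] sq[of q] assms(3) by (intro mult_left_mono) (auto simp only: of_int_le_iff)
  finally show ?thesis .
qed

text \<open>With \<open>a = tri 1 0\<close> and \<open>b = tri 0 1\<close>, the vector \<open>m a + n b\<close> equals \<open>(m + n) a - n (a - b)\<close> and \<open>(m + n) b - m (b - a)\<close>. In
  each of these three bases the two unit vectors are 60 degrees apart, and in one of them the
  coordinates have the same sign.\<close>

lemma form_less:
  fixes m n :: int and A B S :: real
  assumes "\<bar>A\<bar> < S / 2" "\<bar>B\<bar> < S / 2" "\<bar>B - A\<bar> < S / 2" "m \<noteq> 0 \<or> n \<noteq> 0"
  shows "2 * (of_int m * A + of_int n * B) < S * of_int (m\<^sup>2 + m * n + n\<^sup>2)"
proof -
  \<comment> \<open>If m and n have opposite signs, then m + n is 0 or has the sign opposite to one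
    of them.\<close>
  consider "m * n \<ge> 0" | "(m + n) * (- n) \<ge> 0" | "(m + n) * (- m) \<ge> 0"
    by (smt (verit) mult_nonneg_nonneg mult_nonpos_nonpos mult_minus_right)
  then show ?thesis
  proof cases
    case 1
    then show ?thesis using same_sign_form_less[OF assms(1,2)] assms(4) by blast
  next
    case 2
    have "\<bar>A - B\<bar> < S / 2" using assms(3) by linarith
    from same_sign_form_less[OF assms(1) this 2] assms(4)
    show ?thesis by (auto simp: algebra_simps power2_eq_square)
  next
    case 3
    from same_sign_form_less[OF assms(2,3) 3] assms(4)
    show ?thesis by (auto simp: algebra_simps power2_eq_square)
  qed
qed

text \<open>Being closer to v than to w means 2 (x - v) . (w - v) < |w - v|^2. The discs give this
  for the six neighbours w, and \<open>form_less\<close> extends it to every lattice point: the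
  petals lie in the open Voronoi hexagon.\<close>

lemma petals_closest:
  assumes s: "s > 0" and v: "v \<in> tri_lattice s" and w: "w \<in> tri_lattice s" and "v \<noteq> w"
    and x: "x \<in> petals s v"
  shows "dist x v < dist x w"
proof -
  obtain m n where mn: "w - v = s *\<^sub>R tri m n"
    using tri_lattice_diff[OF w v] by (auto simp: tri_lattice_eq)
  have ne: "m \<noteq> 0 \<or> n \<noteq> 0" using mn \<open>v \<noteq> w\<close> by (auto simp: tri_0)
  \<comment> \<open>Absorbing the edge length into y lets all inner products be taken with lattice
    vectors of unit scale, so that \<open>form_less\<close> applies with S = s^2.\<close>
  define y where "y = s *\<^sub>R (x - v)"
  have dir: "y \<bullet> tri i j < s\<^sup>2 / 2" if "i\<^sup>2 + i * j + j\<^sup>2 = 1" for i j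
  proof -
    have "norm (s *\<^sub>R tri i j) = s" using that norm_tri_eq_1_iff[of i j] s by simp
    then have "(x - v) \<bullet> (s *\<^sub>R tri i j) < s\<^sup>2 / 2"
      by (intro inner_petals_less[OF v x]) (auto simp: tri_lattice_eq)
    then show ?thesis by (simp add: y_def)
  qed
  \<comment> \<open>The six edge directions come in three opposite pairs, and each pair bounds one
    absolute value.\<close>
  have "\<bar>y \<bullet> tri 1 0\<bar> < s\<^sup>2 / 2" "\<bar>y \<bullet> tri 0 1\<bar> < s\<^sup>2 / 2" "\<bar>y \<bullet> tri 0 1 - y \<bullet> tri 1 0\<bar> < s\<^sup>2 / 2"
    using dir[of 1 0] dir[of "-1" 0] dir[of 0 1] dir[of 0 "-1"] dir[of 1 "-1"] dir[of "-1" 1]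
      inner_tri[of y "-1" 0] inner_tri[of y 0 "-1"] inner_tri[of y 1 "-1"] inner_tri[of y "-1" 1]
    unfolding abs_less_iff by simp_all
  from form_less[OF this ne]
  have "2 * ((x - v) \<bullet> (w - v)) < s\<^sup>2 * (tri m n \<bullet> tri m n)"
    using inner_tri[of y m n] unfolding mn tri_inner_self by (simp add: y_def)
  also have "\<dots> = (norm (w - v))\<^sup>2"
    by (simp add: mn power_mult_distrib power2_norm_eq_inner)
  finally have "2 * ((x - v) \<bullet> (w - v)) < (norm (w - v))\<^sup>2" .
  moreover have "(norm (x - w))\<^sup>2 = (norm (x - v))\<^sup>2 - 2 * ((x - v) \<bullet> (w - v)) + (norm (w - v))\<^sup>2"
    by (simp add: power2_norm_eq_inner inner_diff_left inner_diff_right inner_commute algebra_simps)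
  ultimately have "(norm (x - v))\<^sup>2 < (norm (x - w))\<^sup>2" by simp
  then show ?thesis by (simp add: dist_norm power_less_imp_less_base)
qed

lemma disjoint_petals:
  assumes "s > 0"
  shows "disjoint_family_on (petals s) (tri_lattice s)"
  unfolding disjoint_family_on_def
proof (intro ballI impI)
  fix v w assume vw: "v \<in> tri_lattice s" "w \<in> tri_lattice s" "v \<noteq> w"
  show "petals s v \<inter> petals s w = {}"
  proof (rule equals0I)
    fix x assume "x \<in> petals s v \<inter> petals s w"
    then have "dist x v < dist x w" "dist x w < dist x v"
      using petals_closest[OF assms] vw by auto
    then show False by simp
  qed
qed

text \<open>Both cells lie in the disc of radius s about the midpoint of the common edge.\<close>

lemma dist_adjacent_petals:
  assumes "u \<in> tri_lattice s" "v \<in> tri_lattice s" "dist u v = s" "x \<in> petals s u" "y \<in> petals s v"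
  shows "dist x y \<le> 2 * s"
proof -
  have "v \<in> tri_nbrs s u" "u \<in> tri_nbrs s v"
    using assms(1-3) by (auto simp: tri_nbrs_def tri_adj_def dist_commute)
  then have "dist (midpoint u v) x \<le> s" "dist (midpoint v u) y \<le> s"
    using assms(4,5) by (auto simp: petals_def flower_eq)
  then show ?thesis
    using dist_triangle2[of x y "midpoint u v"] by (simp add: midpoint_sym dist_commute)
qed

lemma scaleR_tri_lattice: "v \<in> tri_lattice 1 \<Longrightarrow> s *\<^sub>R v \<in> tri_lattice s"
  by (auto simp: tri_lattice_eq)

section \<open>The two families of cells inserted into the percolation argument\<close>

theorem proposition2p7:
  fixes M :: "'w measure"
    and \<Phi> :: "nat \<Rightarrow> 'w \<Rightarrow> (real^'d) set"
    and k :: nat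
    and r l :: "nat \<Rightarrow> real"
    and r\<^sub>0 :: real
  assumes "prob_space M"
    and "CARD('d) \<ge> 2"
    and "k \<ge> 1"
    and "\<And>i. i \<in> {1..k} \<Longrightarrow> r i > 0"
    and "\<And>i. i \<in> {1..k} \<Longrightarrow> l i > 0"
    and "\<And>i. i \<in> {1..k} \<Longrightarrow> poisson_process M (l i) (\<Phi> i)"
    and "prob_space.indep_vars M (\<lambda>_. config_space) \<Phi> {1..k}"
    and "r\<^sub>0 = Inf {r i + r j |i j. i \<in> {1..k} \<and> j \<in> {1..k}}"
    and "(\<Prod>i=1..k. 1 - exp (- l i * a_const CARD('d) r\<^sub>0)) > p_c CARD('d)"
  shows "AE \<omega> in M. \<forall>w \<in> words k. word_occurs (\<lambda>i. \<Phi> i \<omega>) r w"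
proof -
  interpret prob_space M by fact
  let ?R = "{r i + r j |i j. i \<in> {1..k} \<and> j \<in> {1..k}}"
  have "?R \<subseteq> (\<lambda>(i, j). r i + r j) ` ({1..k} \<times> {1..k})" by auto
  then have fin: "finite ?R" by (rule finite_subset) simp
  have "1 \<in> {1..k}" using \<open>k \<ge> 1\<close> by simp
  then have ne: "?R \<noteq> {}" by blast
  have r0_Min: "r\<^sub>0 = Min ?R" unfolding assms(8) using fin ne by (rule cInf_eq_Min)
  have r0_le: "r\<^sub>0 \<le> r i + r j" if "i \<in> {1..k}" "j \<in> {1..k}" for i j
    unfolding r0_Min using that by (intro Min_le fin) blast
  \<comment> \<open>The infimum is over a finite set and hence attained, so it inherits positivity
    from the radii.\<close>
  have "r\<^sub>0 \<in> ?R" unfolding r0_Min using fin ne by (rule Min_in)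
  then obtain i j where "r\<^sub>0 = r i + r j" "i \<in> {1..k}" "j \<in> {1..k}" by blast
  then have "r\<^sub>0 > 0" using assms(4)[of i] assms(4)[of j] by simp
  note AE_words = AE_every_word_occurs[OF assms(3,6,7) r0_le]
  show ?thesis
  proof (cases "CARD('d) = 2")
    case True
    then have "card (UNIV :: 2 set) = card (UNIV :: 'd set)" by simp
    then obtain g :: "2 \<Rightarrow> 'd" where g: "bij g"
      using finite_same_card_bij[of "UNIV :: 2 set" "UNIV :: 'd set"] by auto
    define s where "s = r\<^sub>0 / 2"
    have s: "s > 0" and r0: "r\<^sub>0 = 2 * s" using \<open>r\<^sub>0 > 0\<close> by (simp_all add: s_def)
    \<comment> \<open>\<open>p_c\<close> refers to edge length 1, so cells are indexed by the unit
      lattice and placed at the rescaled site \<open>s *\<^sub>R v\<close>, with s =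
      \<open>r\<^sub>0 / 2\<close> the edge length required for flowers of parameter
      \<open>r\<^sub>0\<close>.\<close>
    define C where "C v = reindex g -` petals s (s *\<^sub>R v)" for v
    show ?thesis
    proof (rule AE_words)
      show "countable (tri_lattice 1)" by (rule countable_tri_lattice)
      show "0 \<in> tri_lattice 1" by (rule zero_in_tri_lattice)
      show "finite {v \<in> tri_lattice 1. tri_adj 1 u v}" if "u \<in> tri_lattice 1" for u
        using that by (rule finite_tri_neighbours)
      show "C v \<in> sets borel \<and> bounded (C v) \<and> measure lborel (C v) = a_const CARD('d) r\<^sub>0"
        if "v \<in> tri_lattice 1" for v
      proof (intro conjI)
        show "C v \<in> sets borel"
          using measurable_sets[OF measurable_reindex borel_petals] by (simp add: C_def)
        have sv: "s *\<^sub>R v \<in> tri_lattice s" using that by (rule scaleR_tri_lattice)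
        have "bounded (petals s (s *\<^sub>R v))"
          by (rule bounded_subset[OF bounded_flower[OF s sv]]) (auto simp: petals_def)
        then obtain B where "\<And>x. x \<in> petals s (s *\<^sub>R v) \<Longrightarrow> norm x \<le> B" by (auto simp: bounded_iff)
        from this[of "reindex g _"] show "bounded (C v)"
          by (intro boundedI[of _ B]) (simp add: C_def norm_reindex[OF g])
        show "measure lborel (C v) = a_const CARD('d) r\<^sub>0"
          unfolding C_def measure_vimage_reindex[OF g borel_petals] measure_petals[OF sv]
          by (simp add: a_const_def True r0)
      qed
      show "disjoint_family_on C (tri_lattice 1)"
        unfolding disjoint_family_on_def
      proof (intro ballI impI)
        fix u v :: "real^2" assume uv: "u \<in> tri_lattice 1" "v \<in> tri_lattice 1" "u \<noteq> v"
        then have "petals s (s *\<^sub>R u) \<inter> petals s (s *\<^sub>R v) = {}"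
          using s by (intro disjoint_family_onD[OF disjoint_petals[OF s]] scaleR_tri_lattice) auto
        then show "C u \<inter> C v = {}" unfolding C_def by blast
      qed
      show "dist y z \<le> r\<^sub>0" if "u \<in> tri_lattice 1" "v \<in> tri_lattice 1" "tri_adj 1 u v" "y \<in> C u" "z \<in> C v"
        for u v y z
      proof -
        have "dist (s *\<^sub>R u) (s *\<^sub>R v) = s" using that(3) s
          by (simp add: tri_adj_def dist_norm flip: scaleR_diff_right)
        then have "dist (reindex g y) (reindex g z) \<le> 2 * s"
          using that by (intro dist_adjacent_petals[of "s *\<^sub>R u" s "s *\<^sub>R v"] scaleR_tri_lattice)
            (auto simp: C_def)
        then show ?thesis by (simp add: dist_reindex[OF g] r0)
      qed
      show "critical_prob (tri_lattice 1) (tri_adj 1) 0 <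
          (\<Prod>i = 1..k. 1 - exp (- l i * a_const CARD('d) r\<^sub>0))"
        using assms(9) by (simp add: p_c_def True)
    qed
  next
    case False
    let ?d = "CARD('d)"
    have "card (UNIV :: 'd set) = card {..<?d}" by simp
    then obtain h :: "'d \<Rightarrow> nat" where h: "bij_betw h UNIV {..<?d}"
      using finite_same_card_bij[of "UNIV :: 'd set" "{..<?d}"] by auto
    \<comment> \<open>With this side the cube has volume \<open>a_const ?d r\<^sub>0\<close>, and
      the distance bound for adjacent cubes is exactly \<open>r\<^sub>0\<close>.\<close>
    define s where "s = r\<^sub>0 / (2 * sqrt (real ?d))"
    have s: "s > 0" and r0: "r\<^sub>0 = 2 * s * sqrt (real ?d)"
      using \<open>r\<^sub>0 > 0\<close> by (simp_all add: s_def)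
    show ?thesis
    proof (rule AE_words)
      show "countable (int_lattice ?d)" by (rule countable_int_lattice)
      show "(\<lambda>i\<in>{..<?d}. 0) \<in> int_lattice ?d" by (simp add: int_lattice_def)
      show "finite {v \<in> int_lattice ?d. linf_adj ?d u v}" for u by (rule finite_linf_neighbours)
      show "cube h s v \<in> sets borel \<and> bounded (cube h s v) \<and>
          measure lborel (cube h s v) = a_const ?d r\<^sub>0" for v
        using False by (simp add: borel_cube bounded_cube measure_cube[OF s] a_const_def flip: s_def)
      show "disjoint_family_on (cube h s) (int_lattice ?d)" using s h by (rule disjoint_cubes)
      show "dist y z \<le> r\<^sub>0" if "linf_adj ?d u v" "y \<in> cube h s u" "z \<in> cube h s v" for u v y z
        unfolding r0 using s h that by (rule dist_adjacent_cubes)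
      show "critical_prob (int_lattice ?d) (linf_adj ?d) (\<lambda>i\<in>{..<?d}. 0) <
          (\<Prod>i = 1..k. 1 - exp (- l i * a_const ?d r\<^sub>0))"
        using assms(9) False by (simp add: p_c_def)
    qed
  qed
qed

end
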